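(* Let $(P,\mathcal{F})$ be a formal distribution (noncommutative) Poisson algebra. Let $\bar{\mathcal{F}}\subseteq P[[z^{\pm1}]]$ be the minimal $\mathbb{C}[\partial_z]$-submodule containing $\mathcal{F}$ which is closed under all $j$-th products $a_{(j)}b$ and $a_{[j]}b$, $j\in\mathbb{N}=\{0,1,2,\dots\}$, regarded as a $\mathbb{C}[\partial]$-module via $(\partial a)(z)=\partial_z a(z)$. For $a,b\in\bar{\mathcal{F}}$ set $$a\circ_\lambda b=\sum_{n\in\mathbb{N}}\frac{\lambda^n}{n!}\,a_{(n)}b,\qquad [a_\lambda b]=\sum_{n\in\mathbb{N}}\frac{\lambda^n}{n!}\,a_{[n]}b .$$ Then $(\bar{\mathcal{F}},\circ_\lambda,[\cdot_\lambda\cdot])$ is a (noncommutative) Poisson conformal algebra. The statement holds in both versions: with the word "(noncommutative)" included throughout, or omitted throughout.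
   Context: All vector spaces are over $\mathbb{C}$. Conformal algebras. A conformal algebra is a $\mathbb{C}[\partial]$-module $A$ with a $\mathbb{C}$-bilinear map $A\times A\to A[\lambda]$, $(a,b)\mapsto a_\lambda b$, such that $(\partial a)_\lambda b=-\lambda\, a_\lambda b$ and $a_\lambda(\partial b)=(\partial+\lambda)(a_\lambda b)$. An associative conformal algebra is a conformal algebra $(A,\circ_\lambda)$ with $a\circ_\lambda(b\circ_\mu c)=(a\circ_\lambda b)\circ_{\lambda+\mu}c$; it is commutative if $a\circ_\lambda b=b\circ_{-\lambda-\partial}a$ (with $\partial$ moved to the left, acting on coefficients). A Lie conformal algebra is a conformal algebra $(A,[\cdot_\lambda\cdot])$ with $[a_\lambda b]=-[b_{-\lambda-\partial}a]$ and $[a_\lambda[b_\mu c]]=[[a_\lambda b]_{\lambda+\mu}c]+[b_\mu[a_\lambda c]]$. A Poisson conformal algebra is a $\mathbb{C}[\partial]$-module with a commutative associative conformal structure $\circ_\lambda$ and a Lie conformal structure $[\cdot_\lambda\cdot]$ satisfying $[a_\lambda(b\circ_\mu c)]=[a_\lambda b]\circ_{\lambda+\mu}c+b\circ_\mu[a_\lambda c]$; a noncommutative Poisson conformal algebra is the same without requiring commutativity of $\circ_\lambda$. A (noncommutative) Poisson algebra is a vector space with a commutative associative (respectively, for "noncommutative", an associative) product $\circ$ and a Lie bracket $[\cdot,\cdot]$ with $[a,b\circ c]=[a,b]\circ c+b\circ[a,c]$. Formal distributions. For a vector space $U$, a $U$-valued formal distribution is a series $a(z)=\sum_{n\in\mathbb{Z}}a_nz^{-n-1}$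 with $a_n\in U$; the space of these is $U[[z^{\pm1}]]$, the $a_n$ are the Fourier coefficients, and $\mathrm{Res}_z a(z)=a_0$. Let $(P,\circ,[\cdot,\cdot])$ be a (noncommutative) Poisson algebra. For $P$-valued formal distributions put $[a(z),b(w)]=\sum_{m,n}[a_m,b_n]z^{-m-1}w^{-n-1}$ and $a(z)\circ b(w)=\sum_{m,n}(a_m\circ b_n)z^{-m-1}w^{-n-1}$. The pair $(a,b)$ is local if for some $N\in\mathbb{N}$ $$(z-w)^N[a(z),b(w)]=0,\quad (z-w)^Na(z)\circ b(w)=0,\quad (z-w)^Nb(z)\circ a(w)=0.$$ The $n$-th products ($n\in\mathbb{N}$) are the formal distributions $$(a_{[n]}b)(w)=\mathrm{Res}_z(z-w)^n[a(z),b(w)],\qquad (a_{(n)}b)(w)=\mathrm{Res}_z(z-w)^na(z)\circ b(w).$$ A formal distribution (noncommutative) Poisson algebra is a pair $(P,\mathcal{F})$ where $P$ is a (noncommutative) Poisson algebra and $\mathcal{F}$ is a family of pairwise local $P$-valued formal distributions (every pair of members, including a member with itself, is local) whose Fourier coefficients span $P$. *)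

theory Defs
  imports
    Complex_Main
    "HOL-Library.Function_Algebras"
    "HOL-Computational_Algebra.Polynomial"
begin

section \<open>Poisson algebras over the complex numbers\<close>

locale noncomm_poisson_algebra = vector_space scale
  for scale :: "complex \<Rightarrow> 'p::ab_group_add \<Rightarrow> 'p" +
  fixes prd :: "'p \<Rightarrow> 'p \<Rightarrow> 'p"
    and brk :: "'p \<Rightarrow> 'p \<Rightarrow> 'p"
  assumes prd_linear_left: "Vector_Spaces.linear scale scale (\<lambda>x. prd x y)"
    and prd_linear_right: "Vector_Spaces.linear scale scale (prd x)"
    and prd_assoc: "prd (prd x y) z = prd x (prd y z)"
    and brk_linear_left: "Vector_Spaces.linear scale scale (\<lambda>x. brk x y)"
    and brk_linear_right: "Vector_Spaces.linear scale scale (brk x)"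
    and brk_self: "brk x x = 0"
    and brk_jacobi: "brk x (brk y z) + brk y (brk z x) + brk z (brk x y) = 0"
    and leibniz: "brk x (prd y z) = prd (brk x y) z + prd y (brk x z)"

locale poisson_algebra = noncomm_poisson_algebra +
  assumes prd_commute: "prd x y = prd y x"


section \<open>Formal distributions\<close>

text \<open>
  A distribution \<open>a(z) = \<Sum>\<^sub>n a\<^sub>n z\<^bsup>-n-1\<^esup>\<close> is encoded by its Fourier coefficients, so
  \<open>a n\<close> is the coefficient of \<open>z\<^bsup>-n-1\<^esup>\<close>, not of \<open>z\<^sup>n\<close>. Likewise, in two variables, \<open>f m n\<close> is the
  coefficient of \<open>z\<^bsup>-m-1\<^esup> w\<^bsup>-n-1\<^esup>\<close>.
\<close>

type_synonym 'p fdist = "int \<Rightarrow> 'p"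
type_synonym 'p fdist2 = "int \<Rightarrow> int \<Rightarrow> 'p"

definition fd_outer :: "('p \<Rightarrow> 'p \<Rightarrow> 'p) \<Rightarrow> 'p fdist \<Rightarrow> 'p fdist \<Rightarrow> 'p fdist2" where
  "fd_outer p a b = (\<lambda>m n. p (a m) (b n))"

text \<open>Multiplication by \<open>z - w\<close>; by the indexing convention, multiplying by \<open>z\<close> replaces the
  coefficient at \<open>m\<close> by the one at \<open>m + 1\<close>.\<close>

definition mult_z_minus_w :: "'p::ab_group_add fdist2 \<Rightarrow> 'p fdist2" where
  "mult_z_minus_w f = (\<lambda>m n. f (m + 1) n - f m (n + 1))"

definition Res_z :: "'p fdist2 \<Rightarrow> 'p fdist" where
  "Res_z f = (\<lambda>n. f 0 n)"

definition fd_nprod ::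
  "('p \<Rightarrow> 'p \<Rightarrow> 'p) \<Rightarrow> nat \<Rightarrow> 'p::ab_group_add fdist \<Rightarrow> 'p fdist \<Rightarrow> 'p fdist" where
  "fd_nprod p n a b = Res_z ((mult_z_minus_w ^^ n) (fd_outer p a b))"

definition fd_local ::
  "('p \<Rightarrow> 'p \<Rightarrow> 'p) \<Rightarrow> ('p \<Rightarrow> 'p \<Rightarrow> 'p) \<Rightarrow> 'p::ab_group_add fdist \<Rightarrow> 'p fdist \<Rightarrow> bool" where
  "fd_local prd brk a b \<longleftrightarrow> (\<exists>N.
     (mult_z_minus_w ^^ N) (fd_outer brk a b) = 0 \<and>
     (mult_z_minus_w ^^ N) (fd_outer prd a b) = 0 \<and>
     (mult_z_minus_w ^^ N) (fd_outer prd b a) = 0)"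

locale fd_noncomm_poisson_algebra = noncomm_poisson_algebra scale prd brk
  for scale :: "complex \<Rightarrow> 'p::ab_group_add \<Rightarrow> 'p" and prd brk +
  fixes \<F> :: "'p fdist set"
  assumes pairwise_local: "a \<in> \<F> \<Longrightarrow> b \<in> \<F> \<Longrightarrow> fd_local prd brk a b"
    and coeffs_span: "span (\<Union>a\<in>\<F>. range a) = UNIV"

locale fd_poisson_algebra =
  fd_noncomm_poisson_algebra scale prd brk \<F> + poisson_algebra scale prd brk
  for scale :: "complex \<Rightarrow> 'p::ab_group_add \<Rightarrow> 'p" and prd brk \<F>

definition fd_deriv :: "(complex \<Rightarrow> 'p \<Rightarrow> 'p) \<Rightarrow> 'p fdist \<Rightarrow> 'p fdist" where
  "fd_deriv scale a = (\<lambda>n. scale (- of_int n) (a (n - 1)))"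

definition fd_act ::
  "(complex \<Rightarrow> 'p \<Rightarrow> 'p) \<Rightarrow> complex poly \<Rightarrow> 'p::ab_group_add fdist \<Rightarrow> 'p fdist" where
  "fd_act scale q a = (\<Sum>i\<le>degree q. (\<lambda>n. scale (coeff q i) ((fd_deriv scale ^^ i) a n)))"

definition fd_closure ::
  "(complex \<Rightarrow> 'p \<Rightarrow> 'p) \<Rightarrow> ('p \<Rightarrow> 'p \<Rightarrow> 'p) \<Rightarrow> ('p \<Rightarrow> 'p \<Rightarrow> 'p) \<Rightarrow>
    'p::ab_group_add fdist set \<Rightarrow> 'p fdist set" where
  "fd_closure scale prd brk \<F> =
     (\<lambda>M. module.subspace (fd_act scale) M \<and>
          (\<forall>a\<in>M. \<forall>b\<in>M. \<forall>j. fd_nprod prd j a b \<in> M \<and> fd_nprod brk j a b \<in> M)) hull \<F>"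

text \<open>The polynomial \<open>\<Sum>\<^sub>n \<lambda>\<^sup>n/n! a\<^bsub>(n)\<^esub>b\<close>. This is only meaningful when finitely many products are
  nonzero (otherwise the sum below is 0 by convention).\<close>

definition fd_lambda ::
  "(complex \<Rightarrow> 'p \<Rightarrow> 'p) \<Rightarrow> ('p \<Rightarrow> 'p \<Rightarrow> 'p) \<Rightarrow>
    'p::ab_group_add fdist \<Rightarrow> 'p fdist \<Rightarrow> 'p fdist poly" where
  "fd_lambda scale p a b =
     (\<Sum>n | fd_nprod p n a b \<noteq> 0. monom (\<lambda>k. scale (1 / fact n) (fd_nprod p n a b k)) n)"


section \<open>Conformal algebras\<close>

text \<open>
  For an additive group \<open>A\<close>, the type of polynomials over \<open>A\<close> serves as \<open>A[\<lambda>]\<close>, and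
  polynomials over that as \<open>A[\<lambda>,\<mu>]\<close> with \<open>\<lambda>\<close> the outer variable. Given an operator \<open>T\<close>,
  \<open>poly_subst T h\<close> sends \<open>\<Sum>\<^sub>i f\<^sub>i x\<^sup>i\<close> to \<open>\<Sum>\<^sub>i T\<^sup>i (h f\<^sub>i)\<close>, i.e. it applies \<open>h\<close> to the coefficients and
  substitutes \<open>T\<close> for the variable, with \<open>T\<close> on the left.
\<close>

definition poly_subst :: "('m \<Rightarrow> 'm) \<Rightarrow> ('a \<Rightarrow> 'm) \<Rightarrow> 'a::zero poly \<Rightarrow> 'm::comm_monoid_add" where
  "poly_subst T h f = (\<Sum>i\<le>degree f. (T ^^ i) (h (coeff f i)))"

text \<open>\<open>f(-\<lambda>-\<partial>)\<close>, with \<open>\<partial>\<close> given by \<open>D\<close>.\<close>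

definition subst_skew :: "('a \<Rightarrow> 'a) \<Rightarrow> 'a::ab_group_add poly \<Rightarrow> 'a poly" where
  "subst_skew D = poly_subst (\<lambda>g. - pCons 0 g - map_poly D g) (\<lambda>x. [:x:])"

definition mult_lam :: "'a::ab_group_add poly poly \<Rightarrow> 'a poly poly" where
  "mult_lam = pCons 0"

definition mult_mu :: "'a::ab_group_add poly poly \<Rightarrow> 'a poly poly" where
  "mult_mu = map_poly (pCons 0)"

definition mult_lam_mu :: "'a::ab_group_add poly poly \<Rightarrow> 'a poly poly" where
  "mult_lam_mu F = mult_lam F + mult_mu F"

text \<open>The element \<open>f(T)\<close> of \<open>A[\<lambda>,\<mu>]\<close>, for \<open>T\<close> one of the three multiplications above.\<close>

definition poly_at :: "('a poly poly \<Rightarrow> 'a poly poly) \<Rightarrow> 'a::ab_group_add poly \<Rightarrow> 'a poly poly" where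
  "poly_at T = poly_subst T (\<lambda>x. [:[:x:]:])"

text \<open>
  \<open>lam_right p T a S g\<close> is \<open>a\<^sub>T g(S)\<close> and \<open>lam_left p T S f c\<close> is \<open>f(S)\<^sub>T c\<close>, where the \<open>\<lambda>\<close>-product \<open>p\<close> is
  extended to polynomial arguments linearly over the formal variables. For instance
  \<open>a\<^sub>\<lambda>(b\<^sub>\<mu> c)\<close> is \<open>lam_right p mult_lam a mult_mu (p b c)\<close>.
\<close>

definition lam_right ::
  "('a \<Rightarrow> 'a \<Rightarrow> 'a poly) \<Rightarrow> ('a poly poly \<Rightarrow> 'a poly poly) \<Rightarrow> 'a \<Rightarrow>
    ('a poly poly \<Rightarrow> 'a poly poly) \<Rightarrow> 'a::ab_group_add poly \<Rightarrow> 'a poly poly" where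
  "lam_right p T a S g = poly_subst S (\<lambda>x. poly_at T (p a x)) g"

definition lam_left ::
  "('a \<Rightarrow> 'a \<Rightarrow> 'a poly) \<Rightarrow> ('a poly poly \<Rightarrow> 'a poly poly) \<Rightarrow>
    ('a poly poly \<Rightarrow> 'a poly poly) \<Rightarrow> 'a::ab_group_add poly \<Rightarrow> 'a \<Rightarrow> 'a poly poly" where
  "lam_left p T S f c = poly_subst S (\<lambda>x. poly_at T (p x c)) f"

text \<open>
  The underlying \<open>\<complex>[\<partial>]\<close>-module is a submodule \<open>A\<close> of a module on the whole type
  (\<open>A = UNIV\<close> is allowed), and the \<open>\<lambda>\<close>-product is only constrained on \<open>A\<close>.
\<close>

locale conformal_algebra = module act
  for act :: "complex poly \<Rightarrow> 'a::ab_group_add \<Rightarrow> 'a" +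
  fixes A :: "'a set"
    and lp :: "'a \<Rightarrow> 'a \<Rightarrow> 'a poly"
  assumes submodule: "subspace A"
    and lp_closed: "\<lbrakk>a \<in> A; b \<in> A\<rbrakk> \<Longrightarrow> coeff (lp a b) n \<in> A"
    and lp_add_left: "\<lbrakk>a \<in> A; a' \<in> A; b \<in> A\<rbrakk> \<Longrightarrow> lp (a + a') b = lp a b + lp a' b"
    and lp_add_right: "\<lbrakk>a \<in> A; b \<in> A; b' \<in> A\<rbrakk> \<Longrightarrow> lp a (b + b') = lp a b + lp a b'"
    and lp_scale_left:
      "\<lbrakk>a \<in> A; b \<in> A\<rbrakk> \<Longrightarrow> lp (act [:c:] a) b = map_poly (act [:c:]) (lp a b)"
    and lp_scale_right:
      "\<lbrakk>a \<in> A; b \<in> A\<rbrakk> \<Longrightarrow> lp a (act [:c:] b) = map_poly (act [:c:]) (lp a b)"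
    and lp_deriv_left:
      "\<lbrakk>a \<in> A; b \<in> A\<rbrakk> \<Longrightarrow> lp (act [:0, 1:] a) b = - pCons 0 (lp a b)"
    and lp_deriv_right:
      "\<lbrakk>a \<in> A; b \<in> A\<rbrakk> \<Longrightarrow>
        lp a (act [:0, 1:] b) = map_poly (act [:0, 1:]) (lp a b) + pCons 0 (lp a b)"

locale assoc_conformal_algebra = conformal_algebra +
  assumes lp_assoc: "\<lbrakk>a \<in> A; b \<in> A; c \<in> A\<rbrakk> \<Longrightarrow>
    lam_right lp mult_lam a mult_mu (lp b c) = lam_left lp mult_lam_mu mult_lam (lp a b) c"

locale comm_assoc_conformal_algebra = assoc_conformal_algebra +
  assumes lp_commute: "\<lbrakk>a \<in> A; b \<in> A\<rbrakk> \<Longrightarrow> lp a b = subst_skew (act [:0, 1:]) (lp b a)"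

locale lie_conformal_algebra = conformal_algebra +
  assumes lp_skew: "\<lbrakk>a \<in> A; b \<in> A\<rbrakk> \<Longrightarrow> lp a b = - subst_skew (act [:0, 1:]) (lp b a)"
    and lp_jacobi: "\<lbrakk>a \<in> A; b \<in> A; c \<in> A\<rbrakk> \<Longrightarrow>
      lam_right lp mult_lam a mult_mu (lp b c) =
        lam_left lp mult_lam_mu mult_lam (lp a b) c + lam_right lp mult_mu b mult_lam (lp a c)"

locale noncomm_poisson_conformal_algebra =
  assoc: assoc_conformal_algebra act A circ + lie: lie_conformal_algebra act A brk
  for act :: "complex poly \<Rightarrow> 'a::ab_group_add \<Rightarrow> 'a" and A circ brk +
  assumes lp_leibniz: "\<lbrakk>a \<in> A; b \<in> A; c \<in> A\<rbrakk> \<Longrightarrow>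
    lam_right brk mult_lam a mult_mu (circ b c) =
      lam_left circ mult_lam_mu mult_lam (brk a b) c + lam_right circ mult_mu b mult_lam (brk a c)"

locale poisson_conformal_algebra =
  noncomm_poisson_conformal_algebra act A circ brk + comm_assoc_conformal_algebra act A circ
  for act :: "complex poly \<Rightarrow> 'a::ab_group_add \<Rightarrow> 'a" and A circ brk

end

theory Submission
  imports Defs
begin

text \<open>
  Associativity, the Jacobi identity and the Leibniz rule for the \<open>\<lambda>\<close>-products are one computation. Write
  the \<open>n\<close>-th product as the residue in \<open>z\<close> of \<open>(z - w)\<^sup>n a(z) b(w)\<close>. An identity
  \<open>x (y z) = (x y) z + y (x z)\<close> in \<open>P\<close>, where each juxtaposition may be a different bilinear operation,
  yields one for the series \<open>a(x), b(y), c(z)\<close>. Multiply it by \<open>(x - z)\<^sup>m (y - z)\<^sup>n\<close>, expand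
  \<open>x - z = (x - y) + (y - z)\<close> in the term \<open>(x y) z\<close> and take residues in \<open>x\<close> and \<open>y\<close>. The result is an
  identity for nested products (\<open>fd_nprod_nested\<close>), and its generating function is
  \<open>a\<^sub>\<lambda>(b\<^sub>\<mu> c) = (a\<^sub>\<lambda> b)\<^bsub>\<lambda>+\<mu>\<^esub> c + b\<^sub>\<mu>(a\<^sub>\<lambda> c)\<close> (\<open>fd_lambda_nested\<close>). For associativity the operations
  in the last term are zero.

  Skew-symmetry and commutativity compare the residue in \<open>z\<close> with the one in \<open>w\<close>. For a series that is
  killed by a power of \<open>z - w\<close>, the expansion of \<open>z\<^sup>i\<close> in powers of \<open>z - w\<close> is finite even for negative
  \<open>i\<close> and does exactly this (\<open>local_expand_z\<close>, \<open>fd_lambda_skew\<close>).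

  What remains is to see that any two members of the closure are local, which also makes the
  \<open>\<lambda>\<close>-products polynomials. By Dong's lemma (\<open>fd_prod_local_nprod\<close>), all products of \<open>a\<close> and \<open>b\<close> are
  local to \<open>c\<close> if \<open>a\<close>, \<open>b\<close> and \<open>c\<close> are pairwise local. It implies that the double commutant of the given
  family with respect to locality is closed under all products, and hence that it contains the
  closure (\<open>Fbar_local\<close>).
\<close>

section \<open>Iterates of additive maps\<close>

lemma additive_funpow:
  fixes T :: "'a::ab_group_add \<Rightarrow> 'a"
  assumes "additive T"
  shows "additive (T ^^ n)"
  by (induction n) (auto simp: additive_def additive.add[OF assms])

lemma funpow_commute_funpow:
  assumes "\<And>x. S (T x) = T (S x)"
  shows "(S ^^ m) ((T ^^ n) x) = (T ^^ n) ((S ^^ m) x)"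
proof -
  have *: "S ((T ^^ n) x) = (T ^^ n) (S x)" for x
    by (induction n) (simp_all add: assms)
  show ?thesis
    by (induction m) (simp_all add: *)
qed

lemma funpow_additive_zero_mono:
  fixes T :: "'a::ab_group_add \<Rightarrow> 'a"
  assumes "additive T" "(T ^^ N) e = 0" "N \<le> M"
  shows "(T ^^ M) e = 0"
proof -
  have "(T ^^ M) e = (T ^^ (M - N)) ((T ^^ N) e)"
    using assms(3) by (simp flip: funpow_add[unfolded o_def fun_eq_iff, rule_format])
  then show ?thesis
    by (simp add: assms(2) additive.zero[OF additive_funpow[OF assms(1)]])
qed

text \<open>
  In every monomial of the expanded power \<open>(U - S)\<^bsup>i+j\<^esup>\<close>, \<open>S\<close> occurs at least \<open>i\<close> times or \<open>U\<close> at
  least \<open>j\<close> times. The induction peels off one factor \<open>U - S\<close> at a time and thereby avoids binomial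
  coefficients.
\<close>

lemma funpow_kill_by_difference:
  assumes S: "additive S" and U: "additive U" and SU: "\<And>x. S (U x) = U (S x)"
    and T: "\<And>x. T x = U x - S x"
  shows "(S ^^ i) e = 0 \<Longrightarrow> (U ^^ j) e = 0 \<Longrightarrow> (T ^^ (i + j)) e = 0"
proof (induction "i + j" arbitrary: i j e)
  case 0
  then show ?case by simp
next
  case (Suc n)
  have T_add: "additive T"
    by (simp add: additive_def T additive.add[OF S] additive.add[OF U])
  note [simp] = additive.zero[OF S] additive.zero[OF U] additive.zero[OF additive_funpow[OF T_add]]
  have S_U: "(S ^^ m) (U x) = U ((S ^^ m) x)" and U_S: "(U ^^ m) (S x) = S ((U ^^ m) x)" for m x
    using funpow_commute_funpow[of S U m 1, OF SU] funpow_commute_funpow[of U S m 1, OF SU[symmetric]]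
    by simp_all
  have "(T ^^ n) (U e) = 0"
  proof (cases j)
    case 0
    then show ?thesis using Suc.prems by simp
  next
    case (Suc j')
    have "(S ^^ i) (U e) = 0"
      by (simp only: S_U Suc.prems) simp
    moreover have "(U ^^ j') (U e) = 0"
      using Suc.prems(2) by (simp only: Suc funpow_Suc_right o_apply)
    ultimately show ?thesis
      using Suc.hyps(1)[of i j' "U e"] \<open>Suc n = i + j\<close> Suc by simp
  qed
  moreover have "(T ^^ n) (S e) = 0"
  proof (cases i)
    case 0
    then show ?thesis using Suc.prems by simp
  next
    case (Suc i')
    have "(U ^^ j) (S e) = 0"
      by (simp only: U_S Suc.prems) simp
    moreover have "(S ^^ i') (S e) = 0"
      using Suc.prems(1) by (simp only: Suc funpow_Suc_right o_apply)
    ultimately show ?thesis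
      using Suc.hyps(1)[of i' j "S e"] \<open>Suc n = i + j\<close> Suc by simp
  qed
  moreover have "(T ^^ Suc n) e = (T ^^ n) (U e) - (T ^^ n) (S e)"
    by (simp only: funpow_Suc_right o_apply T[of e] additive.diff[OF additive_funpow[OF T_add]])
  ultimately have "(T ^^ Suc n) e = 0"
    by simp
  then show ?case
    using Suc.hyps(2) by simp
qed

section \<open>Multiplication by differences of variables\<close>

abbreviation "zw \<equiv> mult_z_minus_w"

lemma additive_mult_z_minus_w: "additive zw"
  by (auto simp: additive_def mult_z_minus_w_def fun_eq_iff)

lemmas zw_pow_zero [simp] = additive.zero[OF additive_funpow[OF additive_mult_z_minus_w]]
lemmas zw_pow_add = additive.add[OF additive_funpow[OF additive_mult_z_minus_w]]
lemmas zw_pow_minus = additive.minus[OF additive_funpow[OF additive_mult_z_minus_w]]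

text \<open>
  Multiplication by \<open>z - w\<close> only forms differences of coefficients, so that it passes through any
  additive map of the values; this is how it is moved in and out of one argument of a product.
\<close>

lemma additive_zw_pow_apply:
  assumes "additive h"
  shows "h ((zw ^^ n) f i k) = (zw ^^ n) (\<lambda>i k. h (f i k)) i k"
  by (induction n arbitrary: i k) (simp_all add: mult_z_minus_w_def additive.diff[OF assms])

text \<open>
  The sign comes from \<open>w - z = -(z - w)\<close>. As a rewrite rule the equation would apply to its own
  right-hand side, hence it is only used by explicit substitution.
\<close>

lemma zw_pow_flip:
  "(zw ^^ n) (\<lambda>i k. f k i) i k =
    (if even n then (zw ^^ n) f k i else - (zw ^^ n) f k i)"
  by (induction n arbitrary: i k) (auto simp: mult_z_minus_w_def)

lemma zw_pow_flip_eq_0: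
  "(zw ^^ n) (\<lambda>i k. f k i) = 0 \<longleftrightarrow> (zw ^^ n) f = 0"
proof -
  have "(zw ^^ n) (\<lambda>i k. f k i) i k = 0 \<longleftrightarrow> (zw ^^ n) f k i = 0" for i k
    by (subst zw_pow_flip) simp
  then show ?thesis
    unfolding fun_eq_iff zero_fun_def by blast
qed

text \<open>
  Coefficients of series in three variables \<open>x, y, z\<close>, again with \<open>E i j k\<close> at
  \<open>x\<^bsup>-i-1\<^esup> y\<^bsup>-j-1\<^esup> z\<^bsup>-k-1\<^esup>\<close>. The operators below multiply by \<open>x - y\<close>, \<open>y - z\<close> and \<open>x - z\<close>.
\<close>

type_synonym 'p fdist3 = "int \<Rightarrow> int \<Rightarrow> int \<Rightarrow> 'p"

definition diff12 :: "'p::ab_group_add fdist3 \<Rightarrow> 'p fdist3" where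
  "diff12 E = (\<lambda>i j k. E (i + 1) j k - E i (j + 1) k)"

definition diff23 :: "'p::ab_group_add fdist3 \<Rightarrow> 'p fdist3" where
  "diff23 E = (\<lambda>i j k. E i (j + 1) k - E i j (k + 1))"

definition diff13 :: "'p::ab_group_add fdist3 \<Rightarrow> 'p fdist3" where
  "diff13 E = (\<lambda>i j k. E (i + 1) j k - E i j (k + 1))"

lemmas diff_operator_defs = diff12_def diff13_def diff23_def

lemma additive_diff_operators: "additive diff12" "additive diff13" "additive diff23"
  by (auto simp: additive_def diff_operator_defs fun_eq_iff)

lemma diff_operators_commute:
  "diff12 (diff13 E) = diff13 (diff12 E)"
  "diff12 (diff23 E) = diff23 (diff12 E)"
  "diff13 (diff23 E) = diff23 (diff13 E)"
  by (auto simp: diff_operator_defs fun_eq_iff algebra_simps)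

lemmas diff_operators_pow_commute =
  funpow_commute_funpow[of diff12 diff13, OF diff_operators_commute(1)]
  funpow_commute_funpow[of diff12 diff23, OF diff_operators_commute(2)]
  funpow_commute_funpow[of diff13 diff23, OF diff_operators_commute(3)]

lemma diff23_eq: "diff23 E = diff13 E - diff12 E"
  by (auto simp: diff_operator_defs fun_eq_iff)

lemma diff_pow_slice:
  "(diff12 ^^ n) E i j k = (zw ^^ n) (\<lambda>i j. E i j k) i j"
  "(diff23 ^^ n) E i j k = (zw ^^ n) (E i) j k"
  "(diff13 ^^ n) E i j k = (zw ^^ n) (\<lambda>i k. E i j k) i k"
  by (induction n arbitrary: i j k) (simp_all add: mult_z_minus_w_def diff_operator_defs)

text \<open>
  The heart of Dong's lemma: since \<open>y - z = (x - z) - (x - y)\<close>, a series that is killed by a power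
  of \<open>x - y\<close> and, up to a factor \<open>(y - z)\<^sup>M\<close>, by a power of \<open>x - z\<close> is killed by a power of \<open>y - z\<close>.
\<close>

lemma diff23_pow_eq_0:
  assumes "(diff12 ^^ N) E = 0" and "(diff13 ^^ K) ((diff23 ^^ M) E) = 0"
  shows "(diff23 ^^ (N + K + M)) E = 0"
proof -
  have "(diff12 ^^ N) ((diff23 ^^ M) E) = 0"
    by (simp add: diff_operators_pow_commute assms(1) additive.zero[OF additive_funpow] additive_diff_operators)
  then have "(diff23 ^^ (N + K)) ((diff23 ^^ M) E) = 0"
    using assms(2)
    by (intro funpow_kill_by_difference[of diff12 diff13])
       (auto simp: additive_diff_operators diff_operators_commute diff23_eq)
  then show ?thesis by (simp add: funpow_add)
qed

text \<open>
  Every iterated product is a coefficient of one series in three variables: an \<open>n\<close>-th product takes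
  the residue, i.e. the coefficient with index \<open>0\<close>, in the variable that disappears. Thus
  \<open>(a\<^bsub>(j)\<^esub>b)\<^bsub>(k)\<^esub>c\<close> eliminates \<open>x\<close> and then \<open>y\<close> from \<open>(y - z)\<^sup>k (x - y)\<^sup>j (a(x) b(y)) c(z)\<close>, and similarly
  for the two other nestings.
\<close>

lemma fd_outer_nprod_left:
  assumes "\<And>z. additive (\<lambda>x. p x z)"
  shows "fd_outer p (fd_nprod q j a b) c =
    (diff12 ^^ j) (\<lambda>x y z. p (q (a x) (b y)) (c z)) 0"
  by (simp add: fun_eq_iff fd_outer_def fd_nprod_def Res_z_def diff_pow_slice
      additive_zw_pow_apply[OF assms])

lemma fd_nprod_nprod_left:
  assumes "\<And>z. additive (\<lambda>x. p x z)"
  shows "fd_nprod p k (fd_nprod q j a b) c n =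
    (diff23 ^^ k) ((diff12 ^^ j) (\<lambda>x y z. p (q (a x) (b y)) (c z))) 0 0 n"
  by (simp add: fd_nprod_def[of p] fd_outer_nprod_left[OF assms] Res_z_def diff_pow_slice(2))

lemma fd_nprod_nprod_right:
  assumes "\<And>x. additive (p x)"
  shows "fd_nprod p m a (fd_nprod q n b c) k =
    (diff13 ^^ m) ((diff23 ^^ n) (\<lambda>x y z. p (a x) (q (b y) (c z)))) 0 0 k"
  by (simp add: fd_outer_def fd_nprod_def Res_z_def diff_pow_slice
      additive_zw_pow_apply[OF assms])

lemma fd_nprod_nprod_right':
  assumes "\<And>x. additive (p x)"
  shows "fd_nprod p n b (fd_nprod q m a c) k =
    (diff13 ^^ m) ((diff23 ^^ n) (\<lambda>x y z. p (b y) (q (a x) (c z)))) 0 0 k"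
proof -
  have "(\<lambda>j k. p (b j) ((zw ^^ m) (\<lambda>x z. q (a x) (c z)) 0 k)) =
    (diff13 ^^ m) (\<lambda>x y z. p (b y) (q (a x) (c z))) 0"
    by (simp add: fun_eq_iff diff_pow_slice(3) additive_zw_pow_apply[OF assms])
  then show ?thesis
    unfolding diff_operators_pow_commute
    by (simp add: fd_outer_def fd_nprod_def Res_z_def diff_pow_slice(2))
qed

section \<open>Locality and Dong's lemma\<close>

text \<open>
  Locality with respect to a single product and in a single order of the factors. The locality of a
  pair is split into three conditions of this kind so that one form of Dong's lemma serves all of
  them; a condition with reversed factors is one for the opposite product.
\<close>

definition fd_prod_local ::
  "('p \<Rightarrow> 'p \<Rightarrow> 'p) \<Rightarrow> 'p::ab_group_add fdist \<Rightarrow> 'p fdist \<Rightarrow> bool" where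
  "fd_prod_local p a b \<longleftrightarrow> (\<exists>N. (zw ^^ N) (fd_outer p a b) = 0)"

lemma fd_local_iff_prod_local:
  "fd_local prd brk a b \<longleftrightarrow>
    fd_prod_local brk a b \<and> fd_prod_local prd a b \<and> fd_prod_local prd b a"
proof -
  have "\<exists>N. (zw ^^ N) f = 0 \<and> (zw ^^ N) g = 0 \<and> (zw ^^ N) h = 0"
    if "(zw ^^ K) f = 0" "(zw ^^ L) g = 0" "(zw ^^ M) h = 0"
    for K L M and f g h :: "'a fdist2"
    using that funpow_additive_zero_mono[OF additive_mult_z_minus_w, of _ _ "K + L + M"]
    by (intro exI[of _ "K + L + M"]) force
  then show ?thesis
    unfolding fd_local_def fd_prod_local_def by blast
qed

lemma fd_prod_local_swap: "fd_prod_local (\<lambda>x y. p y x) b a \<longleftrightarrow> fd_prod_local p a b"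
  unfolding fd_prod_local_def fd_outer_def
  by (simp only: zw_pow_flip_eq_0[of _ "\<lambda>i k. p (a i) (b k)"])

lemma fd_nprod_finite:
  assumes "fd_prod_local p a b"
  shows "finite {n. fd_nprod p n a b \<noteq> 0}"
proof -
  obtain N where N: "(zw ^^ N) (fd_outer p a b) = 0"
    using assms by (auto simp: fd_prod_local_def)
  have "fd_nprod p n a b = 0" if "N \<le> n" for n
    using funpow_additive_zero_mono[OF additive_mult_z_minus_w N that]
    by (simp add: fd_nprod_def Res_z_def fun_eq_iff)
  then have "{n. fd_nprod p n a b \<noteq> 0} \<subseteq> {..<N}"
    by (force simp: not_le[symmetric])
  then show ?thesis by (rule finite_subset) simp
qed

text \<open>
  Dong's lemma. Consider \<open>E = p (q a(x) b(y)) c(z)\<close>. Locality of \<open>a, b\<close> kills it by a power of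
  \<open>x - y\<close>. The first term of the expansion is killed by a power of \<open>y - z\<close>, the second one by a
  power of \<open>x - z\<close>, and then the whole by a power of \<open>y - z\<close>, which survives multiplication by \<open>(x - y)\<^sup>j\<close>
  and the residue in \<open>x\<close>. Associativity, the Leibniz rule and the Jacobi identity all have the shape
  of the expansion.
\<close>

lemma fd_prod_local_nprod:
  assumes p: "\<And>z. additive (\<lambda>x. p x z)" and s: "\<And>x. additive (s x)" and t: "\<And>x. additive (t x)"
    and expand: "\<And>x y z. p (q x y) z = s x (s' y z) + t y (t' x z)"
    and ab: "fd_prod_local q a b" and bc: "fd_prod_local s' b c" and ac: "fd_prod_local t' a c"
  shows "fd_prod_local p (fd_nprod q j a b) c"
proof -
  obtain N M K where N: "(zw ^^ N) (fd_outer q a b) = 0"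
    and M: "(zw ^^ M) (fd_outer s' b c) = 0" and K: "(zw ^^ K) (fd_outer t' a c) = 0"
    using ab bc ac by (auto simp: fd_prod_local_def)
  define E where "E = (\<lambda>x y z. p (q (a x) (b y)) (c z))"
  define E1 where "E1 = (\<lambda>x y z. s (a x) (s' (b y) (c z)))"
  define E2 where "E2 = (\<lambda>x y z. t (b y) (t' (a x) (c z)))"
  have E: "E = E1 + E2"
    by (simp add: fun_eq_iff E_def E1_def E2_def expand)
  note z = additive.zero[OF p] additive.zero[OF s] additive.zero[OF t]
  have "(diff12 ^^ N) E = 0"
    using N by (simp add: fun_eq_iff diff_pow_slice E_def fd_outer_def z
        flip: additive_zw_pow_apply[OF p])
  moreover have "(diff23 ^^ M) E1 = 0"
    using M by (simp add: fun_eq_iff diff_pow_slice E1_def fd_outer_def z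
        flip: additive_zw_pow_apply[OF s])
  moreover have "(diff13 ^^ K) E2 = 0"
    using K by (simp add: fun_eq_iff diff_pow_slice E2_def fd_outer_def z
        flip: additive_zw_pow_apply[OF t])
  ultimately have "(diff23 ^^ (N + K + M)) E = 0"
    by (intro diff23_pow_eq_0)
      (simp_all add: E additive.add[OF additive_funpow] additive.zero[OF additive_funpow]
        additive_diff_operators diff_operators_pow_commute)
  then have "(diff23 ^^ (N + K + M)) ((diff12 ^^ j) E) = 0"
    by (simp flip: diff_operators_pow_commute add: additive.zero[OF additive_funpow] additive_diff_operators)
  then have "(zw ^^ (N + K + M)) (fd_outer p (fd_nprod q j a b) c) = 0"
    by (simp add: fun_eq_iff diff_pow_slice(2) fd_outer_nprod_left[OF p] flip: E_def)
  then show ?thesis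
    by (auto simp: fd_prod_local_def)
qed

section \<open>Distributions as a module over the polynomials in the derivative\<close>

locale complex_vector_space = vector_space scale
  for scale :: "complex \<Rightarrow> 'p::ab_group_add \<Rightarrow> 'p"
begin

definition bilinear_op :: "('p \<Rightarrow> 'p \<Rightarrow> 'p) \<Rightarrow> bool" where
  "bilinear_op p \<longleftrightarrow>
    (\<forall>y. Vector_Spaces.linear scale scale (\<lambda>x. p x y)) \<and>
    (\<forall>x. Vector_Spaces.linear scale scale (p x))"

lemma bilinear_op_swap: "bilinear_op p \<Longrightarrow> bilinear_op (\<lambda>x y. p y x)"
  by (simp add: bilinear_op_def)

lemma bilinear_op_additive:
  assumes "bilinear_op p"
  shows "additive (\<lambda>x. p x y)" "additive (p x)"
  using assms by (auto simp: bilinear_op_def Vector_Spaces.linear_iff additive_def)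

lemma bilinear_op_scale:
  assumes "bilinear_op p"
  shows "p (scale c x) y = scale c (p x y)" "p x (scale c y) = scale c (p x y)"
  using assms by (auto simp: bilinear_op_def Vector_Spaces.linear_iff)

lemma bilinear_op_zero: "bilinear_op (\<lambda>x y. 0)"
  by (auto simp: bilinear_op_def Vector_Spaces.linear_iff vector_space_axioms)

definition fd_scale :: "complex \<Rightarrow> 'p fdist \<Rightarrow> 'p fdist" where
  "fd_scale c a = (\<lambda>n. scale c (a n))"

sublocale fd: vector_space fd_scale
  by unfold_locales
    (simp_all add: fd_scale_def fun_eq_iff scale_right_distrib scale_left_distrib)

abbreviation "D \<equiv> fd_deriv scale"

lemma fd_deriv_linear:
  "D (a + b) = D a + D b" "D (fd_scale c a) = fd_scale c (D a)" "D 0 = 0"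
  by (simp_all add: fd_deriv_def fd_scale_def fun_eq_iff scale_right_distrib ac_simps)

lemma additive_fd_deriv: "additive D"
  by (simp add: additive_def fd_deriv_linear)

lemma fd_deriv_pow_scale: "(D ^^ i) (fd_scale c a) = fd_scale c ((D ^^ i) a)"
  by (induction i) (simp_all add: fd_deriv_linear)

text \<open>
  The action of \<open>\<complex>[\<partial>]\<close> as a sum with any sufficiently large range, so that polynomials of different
  degrees can be compared.
\<close>

lemma fd_act_eq_sum:
  assumes "degree q \<le> N"
  shows "fd_act scale q a = (\<Sum>i\<le>N. fd_scale (coeff q i) ((D ^^ i) a))"
proof -
  have "fd_act scale q a = (\<Sum>i\<le>degree q. fd_scale (coeff q i) ((D ^^ i) a))"
    by (simp add: fd_act_def fd_scale_def)
  also have "\<dots> = (\<Sum>i\<le>N. fd_scale (coeff q i) ((D ^^ i) a))"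
    using assms by (intro sum.mono_neutral_left) (auto simp: coeff_eq_0)
  finally show ?thesis .
qed

lemma fd_act_pCons: "fd_act scale (pCons c q) a = fd_scale c a + D (fd_act scale q a)"
proof -
  have "fd_act scale (pCons c q) a =
      (\<Sum>i\<le>Suc (degree q). fd_scale (coeff (pCons c q) i) ((D ^^ i) a))"
    by (intro fd_act_eq_sum degree_pCons_le)
  then show ?thesis
    by (simp add: sum.atMost_Suc_shift fd_act_eq_sum[of q "degree q"] fd_deriv_linear
        additive.sum[OF additive_fd_deriv] del: sum.atMost_Suc)
qed

lemma fd_act_0: "fd_act scale 0 a = 0"
  by (simp add: fd_act_def func_zero)

lemma fd_act_const: "fd_act scale [:c:] a = fd_scale c a"
  by (simp add: fd_act_pCons fd_act_0 fd_deriv_linear)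

lemma fd_act_X: "fd_act scale [:0, 1:] a = D a"
  by (simp add: fd_act_pCons fd_act_0 fd_deriv_linear)

lemma fd_act_add_left: "fd_act scale (p + q) a = fd_act scale p a + fd_act scale q a"
proof -
  let ?N = "max (degree p) (degree q)"
  have "degree (p + q) \<le> ?N" by (simp add: degree_add_le)
  then show ?thesis
    by (simp add: fd_act_eq_sum[of _ ?N] fd.scale_left_distrib sum.distrib)
qed

lemma fd_act_smult: "fd_act scale (smult c q) a = fd_scale c (fd_act scale q a)"
  by (simp add: fd_act_eq_sum[of _ "degree q"] degree_smult_le fd.scale_sum_right)

lemma fd_act_mult: "fd_act scale (p * q) a = fd_act scale p (fd_act scale q a)"
  by (induction p)
    (simp_all add: fd_act_0 fd_act_add_left fd_act_smult fd_act_pCons)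

lemma module_fd_act: "module (fd_act scale)"
proof
  show "fd_act scale q (a + b) = fd_act scale q a + fd_act scale q b" for q a b
    by (simp add: fd_act_eq_sum[of _ "degree q"] fd.scale_right_distrib sum.distrib
        additive.add[OF additive_funpow[OF additive_fd_deriv]])
  show "fd_act scale 1 a = a" for a
    by (simp add: one_pCons fd_act_const)
qed (simp_all add: fd_act_add_left fd_act_mult)

text \<open>
  A subset is a \<open>\<complex>[\<partial>]\<close>-submodule as soon as it is a linear subspace closed under \<open>\<partial>\<close>.
\<close>

lemma fd_act_closed:
  assumes "0 \<in> M" "\<And>a b. a \<in> M \<Longrightarrow> b \<in> M \<Longrightarrow> a + b \<in> M"
    "\<And>c a. a \<in> M \<Longrightarrow> fd_scale c a \<in> M" "\<And>a. a \<in> M \<Longrightarrow> D a \<in> M" "a \<in> M"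
  shows "fd_act scale q a \<in> M"
  using assms(5)
  by (induction q) (simp_all add: fd_act_0 fd_act_pCons assms(1-4))

section \<open>Sesquilinearity of the products\<close>

lemma zw_pow_scale: "(zw ^^ n) (\<lambda>i k. scale c (f i k)) i k = scale c ((zw ^^ n) f i k)"
  by (induction n arbitrary: i k) (simp_all add: mult_z_minus_w_def scale_right_diff_distrib)

text \<open>
  The partial derivatives of a series in \<open>z, w\<close>. They commute with multiplication by \<open>z - w\<close> up to a
  correction term, since the derivatives of \<open>z - w\<close> are \<open>1\<close> and \<open>-1\<close>. As the residue in \<open>z\<close> of a \<open>z\<close>-derivative
  vanishes, only the correction term survives in the product with \<open>\<partial>a\<close> on the left.
\<close>

definition deriv_z :: "'p fdist2 \<Rightarrow> 'p fdist2" where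
  "deriv_z f = (\<lambda>i k. scale (- of_int i) (f (i - 1) k))"

definition deriv_w :: "'p fdist2 \<Rightarrow> 'p fdist2" where
  "deriv_w f = (\<lambda>i k. scale (- of_int k) (f i (k - 1)))"

lemma zw_pow_deriv_z:
  "(zw ^^ n) (deriv_z f) = deriv_z ((zw ^^ n) f) - (\<lambda>i k. scale (of_nat n) ((zw ^^ (n - 1)) f i k))"
proof (induction n)
  case 0
  then show ?case by (simp add: fun_eq_iff)
next
  case (Suc n)
  have "zw (deriv_z g) = deriv_z (zw g) - g" for g
    by (auto simp: fun_eq_iff mult_z_minus_w_def deriv_z_def algebra_simps scale_left_distrib)
  moreover have "zw (\<lambda>i k. scale (of_nat n) ((zw ^^ (n - 1)) f i k)) =
      (\<lambda>i k. scale (of_nat n) ((zw ^^ n) f i k))"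
    using zw_pow_scale[of 1 "of_nat n" "(zw ^^ (n - 1)) f"]
    by (cases n) (auto simp: fun_eq_iff)
  moreover have "(zw ^^ Suc n) (deriv_z f) = zw (deriv_z ((zw ^^ n) f)) -
      zw (\<lambda>i k. scale (of_nat n) ((zw ^^ (n - 1)) f i k))"
    by (simp only: funpow.simps o_apply Suc.IH additive.diff[OF additive_mult_z_minus_w])
  ultimately have "(zw ^^ Suc n) (deriv_z f) = deriv_z ((zw ^^ Suc n) f) - (zw ^^ n) f -
      (\<lambda>i k. scale (of_nat n) ((zw ^^ n) f i k))"
    by simp
  then show ?case
    by (simp add: fun_eq_iff scale_left_distrib algebra_simps del: funpow.simps)
qed

lemma zw_pow_deriv_w:
  "(zw ^^ n) (deriv_w f) = deriv_w ((zw ^^ n) f) + (\<lambda>i k. scale (of_nat n) ((zw ^^ (n - 1)) f i k))"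
proof (induction n)
  case 0
  then show ?case by (simp add: fun_eq_iff)
next
  case (Suc n)
  have "zw (deriv_w g) = deriv_w (zw g) + g" for g
    by (auto simp: fun_eq_iff mult_z_minus_w_def deriv_w_def algebra_simps scale_left_distrib)
  moreover have "zw (\<lambda>i k. scale (of_nat n) ((zw ^^ (n - 1)) f i k)) =
      (\<lambda>i k. scale (of_nat n) ((zw ^^ n) f i k))"
    using zw_pow_scale[of 1 "of_nat n" "(zw ^^ (n - 1)) f"]
    by (cases n) (auto simp: fun_eq_iff)
  moreover have "(zw ^^ Suc n) (deriv_w f) = zw (deriv_w ((zw ^^ n) f)) +
      zw (\<lambda>i k. scale (of_nat n) ((zw ^^ (n - 1)) f i k))"
    by (simp only: funpow.simps o_apply Suc.IH additive.add[OF additive_mult_z_minus_w])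
  ultimately have "(zw ^^ Suc n) (deriv_w f) = deriv_w ((zw ^^ Suc n) f) + (zw ^^ n) f +
      (\<lambda>i k. scale (of_nat n) ((zw ^^ n) f i k))"
    by simp
  then show ?case
    by (simp add: fun_eq_iff scale_left_distrib algebra_simps del: funpow.simps)
qed

context
  fixes p assumes p: "bilinear_op p"
begin

lemma fd_outer_linear:
  "fd_outer p (a + a') b = fd_outer p a b + fd_outer p a' b"
  "fd_outer p a (b + b') = fd_outer p a b + fd_outer p a b'"
  "fd_outer p (fd_scale c a) b = (\<lambda>i k. scale c (fd_outer p a b i k))"
  "fd_outer p a (fd_scale c b) = (\<lambda>i k. scale c (fd_outer p a b i k))"
  "fd_outer p 0 b = 0" "fd_outer p a 0 = 0"
  using bilinear_op_additive[OF p, THEN additive.add] bilinear_op_additive[OF p, THEN additive.zero]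
  by (auto simp: fd_outer_def fd_scale_def fun_eq_iff bilinear_op_scale[OF p])

lemma fd_outer_deriv:
  "fd_outer p (D a) b = deriv_z (fd_outer p a b)"
  "fd_outer p a (D b) = deriv_w (fd_outer p a b)"
  by (simp_all add: fd_outer_def fd_deriv_def fun_eq_iff bilinear_op_scale[OF p]
      deriv_z_def deriv_w_def bilinear_op_additive[OF p, THEN additive.minus])

lemma fd_nprod_add:
  "fd_nprod p n (a + a') b = fd_nprod p n a b + fd_nprod p n a' b"
  "fd_nprod p n a (b + b') = fd_nprod p n a b + fd_nprod p n a b'"
  by (simp_all add: fd_nprod_def Res_z_def fd_outer_linear zw_pow_add fun_eq_iff)

lemma fd_nprod_scale:
  "fd_nprod p n (fd_scale c a) b = fd_scale c (fd_nprod p n a b)"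
  "fd_nprod p n a (fd_scale c b) = fd_scale c (fd_nprod p n a b)"
  by (simp_all only: fd_nprod_def Res_z_def fd_outer_linear zw_pow_scale)
    (simp_all add: fd_scale_def)

lemma fd_nprod_deriv_left:
  "fd_nprod p n (D a) b = - fd_scale (of_nat n) (fd_nprod p (n - 1) a b)"
  by (simp only: fd_nprod_def Res_z_def fd_outer_deriv zw_pow_deriv_z)
    (simp add: fun_eq_iff fd_scale_def deriv_z_def)

lemma fd_nprod_deriv_right:
  "fd_nprod p n a (D b) = D (fd_nprod p n a b) + fd_scale (of_nat n) (fd_nprod p (n - 1) a b)"
  by (simp only: fd_nprod_def Res_z_def fd_outer_deriv zw_pow_deriv_w)
    (simp add: fun_eq_iff fd_scale_def deriv_w_def fd_deriv_def)

lemma fd_prod_local_add: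
  assumes "fd_prod_local p a b" "fd_prod_local p a' b"
  shows "fd_prod_local p (a + a') b"
proof -
  obtain N M where "(zw ^^ N) (fd_outer p a b) = 0" "(zw ^^ M) (fd_outer p a' b) = 0"
    using assms by (auto simp: fd_prod_local_def)
  then have "(zw ^^ (max N M)) (fd_outer p (a + a') b) = 0"
    by (simp add: fd_outer_linear zw_pow_add
        funpow_additive_zero_mono[OF additive_mult_z_minus_w, of N _ "max N M"]
        funpow_additive_zero_mono[OF additive_mult_z_minus_w, of M _ "max N M"])
  then show ?thesis by (auto simp: fd_prod_local_def)
qed

lemma fd_prod_local_scale:
  assumes "fd_prod_local p a b"
  shows "fd_prod_local p (fd_scale c a) b"
  using assms by (auto simp: fd_prod_local_def fd_outer_linear zw_pow_scale fun_eq_iff)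

lemma fd_prod_local_zero: "fd_prod_local p 0 b"
  by (simp add: fd_prod_local_def fd_outer_linear)

lemma fd_prod_local_deriv:
  assumes "fd_prod_local p a b"
  shows "fd_prod_local p (D a) b"
proof -
  obtain N where N: "(zw ^^ N) (fd_outer p a b) = 0"
    using assms by (auto simp: fd_prod_local_def)
  have "(zw ^^ Suc N) (fd_outer p (D a) b) = 0"
    by (simp only: fd_outer_deriv zw_pow_deriv_z)
      (simp add: N additive.zero[OF additive_mult_z_minus_w] fun_eq_iff deriv_z_def)
  then show ?thesis unfolding fd_prod_local_def by blast
qed

end

section \<open>Exchanging the factors\<close>

text \<open>
  Expanding \<open>z\<^sup>i = (w + (z - w))\<^sup>i\<close> expresses all coefficients of \<open>g\<close> through the residues of
  \<open>(z - w)\<^sup>j g\<close>. For negative \<open>i\<close> the binomial series is infinite, but locality truncates it at \<open>N\<close>.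
\<close>

lemma local_expand_z:
  "(zw ^^ N) g = 0 \<Longrightarrow>
    g i k = (\<Sum>j<N. scale (of_int i gchoose j) ((zw ^^ j) g 0 (k + i - int j)))"
proof (induction N arbitrary: g i k)
  case 0
  then show ?case by simp
next
  case (Suc N)
  define S where "S = (\<lambda>i k. \<Sum>j<Suc N. scale (of_int i gchoose j) ((zw ^^ j) g 0 (k + i - int j)))"
  define e where "e = (\<lambda>i k. g i k - S i k)"
  have "(zw ^^ N) (zw g) = 0"
    using Suc.prems by (simp only: funpow_Suc_right o_apply)
  note IH = Suc.IH[OF this]
  have S0: "S 0 k = g 0 k" for k
    unfolding S_def sum.lessThan_Suc_shift by simp
  \<comment> \<open>Pascal's rule and the induction hypothesis for \<open>(z - w) g\<close> show that the right-hand side obeys the same recursion as \<open>g\<close>.\<close>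
  have step: "S (i + 1) k - S i (k + 1) = g (i + 1) k - g i (k + 1)" for i k
  proof -
    have "(of_int (i + 1) gchoose Suc j) - (of_int i gchoose Suc j) = (of_int i gchoose j :: complex)" for j
      by (simp add: gbinomial_Suc_Suc)
    then have "S (i + 1) k - S i (k + 1) =
      (\<Sum>j<N. scale (of_int i gchoose j) ((zw ^^ Suc j) g 0 (k + i - int j)))"
      unfolding S_def sum.lessThan_Suc_shift
      by (simp add: ac_simps del: funpow.simps of_int_add
          flip: sum_subtractf scale_left_diff_distrib)
    also have "\<dots> = zw g i k"
      by (subst IH) (simp only: funpow_Suc_right o_apply)
    finally show ?thesis by (simp add: mult_z_minus_w_def)
  qed
  have e_step: "e (i + 1) k = e i (k + 1)" for i k
    using step[of i k] by (simp add: e_def algebra_simps)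
  \<comment> \<open>The error depends only on \<open>i + k\<close>, and it vanishes for \<open>i = 0\<close>.\<close>
  have e_zero: "e i k = 0" for i k
  proof (induction i arbitrary: k rule: int_induct[where k = 0])
    case base
    then show ?case by (simp add: e_def S0)
  next
    case (step1 i)
    then show ?case by (simp add: e_step)
  next
    case (step2 i)
    then show ?case using e_step[of "i - 1" "k - 1"] by simp
  qed
  show ?case
    using e_zero[of i k] by (simp add: e_def S_def del: sum.lessThan_Suc funpow.simps)
qed

text \<open>
  Exchanging the factors exchanges \<open>z\<close> and \<open>w\<close>, and so replaces the residue in \<open>z\<close> by the one in \<open>w\<close>;
  the preceding expansion of \<open>(z - w)\<^sup>n b(z) a(w)\<close> brings it back to residues in \<open>z\<close>. Since
  \<open>(-\<partial>)\<^sup>j/j!\<close> acts on a coefficient with index \<open>k\<close> as \<open>k gchoose j\<close> times the coefficient with index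
  \<open>k - j\<close>, this is the coefficient form of \<open>a\<^sub>\<lambda>b = \<epsilon> b\<^bsub>-\<lambda>-\<partial>\<^esub>a\<close>.
\<close>

lemma fd_nprod_skew:
  assumes swap: "\<And>x y. p y x = scale \<epsilon> (p x y)"
    and N: "(zw ^^ N) (fd_outer p b a) = 0"
  shows "fd_nprod p n a b k =
    scale (\<epsilon> * (-1) ^ n) (\<Sum>j<N. scale (of_int k gchoose j) (fd_nprod p (n + j) b a (k - int j)))"
proof -
  have "fd_outer p a b = (\<lambda>i k. scale \<epsilon> (fd_outer p b a k i))"
    by (auto simp: fd_outer_def fun_eq_iff intro: swap)
  then have "fd_nprod p n a b k = scale \<epsilon> ((zw ^^ n) (\<lambda>i k. fd_outer p b a k i) 0 k)"
    by (simp add: fd_nprod_def Res_z_def zw_pow_scale)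
  also have "\<dots> = scale (\<epsilon> * (-1) ^ n) ((zw ^^ n) (fd_outer p b a) k 0)"
    by (subst zw_pow_flip) simp
  also have "(zw ^^ n) (fd_outer p b a) k 0 =
    (\<Sum>j<N. scale (of_int k gchoose j) (fd_nprod p (n + j) b a (k - int j)))"
  proof -
    have "(zw ^^ N) ((zw ^^ n) (fd_outer p b a)) = 0"
      using funpow_additive_zero_mono[OF additive_mult_z_minus_w N, of "N + n"]
      by (simp add: funpow_add)
    moreover have "(zw ^^ j) ((zw ^^ n) f) = (zw ^^ (n + j)) f" for j and f :: "'p fdist2"
      by (simp add: funpow_add add.commute[of n])
    ultimately show ?thesis
      by (subst local_expand_z) (simp_all add: fd_nprod_def Res_z_def)
  qed
  finally show ?thesis .
qed

section \<open>Nested products\<close>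

text \<open>
  The binomial theorem for an array: think of \<open>H j m n\<close> as a functional applied to
  \<open>S\<^sup>j (S + T)\<^sup>m T\<^sup>n\<close> with commuting \<open>S\<close> and \<open>T\<close>.
\<close>

lemma binomial_recursion:
  assumes "\<And>j m n. H j (Suc m) n = H (Suc j) m n + H j m (Suc n)"
  shows "H j m n = (\<Sum>i\<le>m. scale (of_nat (m choose i)) (H (j + i) 0 (n + m - i)))"
proof (induction m arbitrary: j n)
  case 0
  then show ?case by simp
next
  case (Suc m)
  have "(\<Sum>i\<le>m. scale (of_nat (m choose i)) (H (j + i) 0 (Suc n + m - i))) =
      (\<Sum>i\<le>Suc m. scale (of_nat (m choose i)) (H (j + i) 0 (n + Suc m - i)))"
    by simp
  also have "\<dots> = H j 0 (n + Suc m) +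
      (\<Sum>i\<le>m. scale (of_nat (m choose Suc i)) (H (Suc j + i) 0 (n + m - i)))"
    by (subst sum.atMost_Suc_shift) simp
  finally show ?case
    by (simp add: assms Suc.IH sum.atMost_Suc_shift scale_left_distrib sum.distrib
        del: sum.atMost_Suc)
qed

text \<open>
  Apply \<open>(x - z)\<^sup>m (y - z)\<^sup>n\<close> to the expansion of \<open>a(x) (b(y) c(z))\<close> and take residues in \<open>x\<close> and \<open>y\<close>.
  In the first term \<open>x - z = (x - y) + (y - z)\<close> is expanded binomially, so that each summand becomes
  a product nested on the left. Six independent products make the identity cover associativity
  (with a vanishing last term), the Jacobi identity and the Leibniz rule at once.
\<close>

lemma fd_nprod_nested:
  assumes p: "\<And>x. additive (p1 x)" "\<And>x. additive (\<lambda>y. p3 y x)" "\<And>x. additive (p5 x)"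
    and expand: "\<And>x y z. p1 x (p2 y z) = p3 (p4 x y) z + p5 y (p6 x z)"
  shows "fd_nprod p1 m a (fd_nprod p2 n b c) k =
    (\<Sum>j\<le>m. scale (of_nat (m choose j)) (fd_nprod p3 (n + m - j) (fd_nprod p4 j a b) c k)) +
    fd_nprod p5 n b (fd_nprod p6 m a c) k"
proof -
  define E where "E = (\<lambda>x y z. p3 (p4 (a x) (b y)) (c z))"
  define E' where "E' = (\<lambda>x y z. p5 (b y) (p6 (a x) (c z)))"
  define H where "H j m n = (diff12 ^^ j) ((diff13 ^^ m) ((diff23 ^^ n) E)) 0 0 k" for j m n
  have "fd_nprod p1 m a (fd_nprod p2 n b c) k = (diff13 ^^ m) ((diff23 ^^ n) (E + E')) 0 0 k"
    unfolding fd_nprod_nprod_right[OF p(1)]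
    by (simp add: E_def E'_def expand plus_fun_def)
  also have "\<dots> = H 0 m n + fd_nprod p5 n b (fd_nprod p6 m a c) k"
    by (simp add: fd_nprod_nprod_right'[OF p(3)] H_def E'_def additive_diff_operators
        additive.add[OF additive_funpow])
  also have "H 0 m n = (\<Sum>i\<le>m. scale (of_nat (m choose i)) (H i 0 (n + m - i)))"
  proof -
    have "H j (Suc m) n = H (Suc j) m n + H j m (Suc n)" for j m n
    proof -
      have "diff13 G = diff12 G + diff23 G" for G :: "'p fdist3"
        by (simp add: diff23_eq)
      then have "(diff12 ^^ j) ((diff13 ^^ m) (diff13 ((diff23 ^^ n) E))) =
          (diff12 ^^ j) ((diff13 ^^ m) (diff12 ((diff23 ^^ n) E))) +
          (diff12 ^^ j) ((diff13 ^^ m) (diff23 ((diff23 ^^ n) E)))"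
        by (simp add: additive.add[OF additive_funpow] additive_diff_operators)
      moreover have "(diff13 ^^ m) (diff12 G) = diff12 ((diff13 ^^ m) G)" for G :: "'p fdist3"
        using diff_operators_pow_commute(1)[of 1 m G] by simp
      ultimately show ?thesis
        by (simp add: H_def funpow_swap1)
    qed
    then show ?thesis
      by (subst binomial_recursion) simp_all
  qed
  finally have eq: "fd_nprod p1 m a (fd_nprod p2 n b c) k =
    (\<Sum>i\<le>m. scale (of_nat (m choose i)) (H i 0 (n + m - i))) + fd_nprod p5 n b (fd_nprod p6 m a c) k" .
  have "H j 0 l = fd_nprod p3 l (fd_nprod p4 j a b) c k" for j l
    unfolding fd_nprod_nprod_left[OF p(2)] H_def E_def by (simp add: diff_operators_pow_commute)
  then show ?thesis by (simp add: eq)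
qed

end

section \<open>Coefficients of substituted polynomials\<close>

text \<open>
  In what follows the identities between polynomials are reduced to identities between
  coefficients. This lemma frees \<^const>\<open>poly_subst\<close> from the exact degree of the polynomial.
\<close>

lemma poly_subst_eq_sum:
  assumes "\<And>i. i \<ge> N \<Longrightarrow> coeff f i = 0" and "\<And>i. (T ^^ i) (h 0) = 0"
  shows "poly_subst T h f = (\<Sum>i<N. (T ^^ i) (h (coeff f i)))"
proof -
  let ?M = "max N (Suc (degree f))"
  have "poly_subst T h f = (\<Sum>i<?M. (T ^^ i) (h (coeff f i)))"
    unfolding poly_subst_def using assms(2)
    by (intro sum.mono_neutral_left) (auto simp: coeff_eq_0)
  also have "\<dots> = (\<Sum>i<N. (T ^^ i) (h (coeff f i)))"
    using assms by (intro sum.mono_neutral_right) (auto simp: not_less)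
  finally show ?thesis .
qed

lemma coeff_mult_lam_pow:
  "coeff (coeff ((mult_lam ^^ i) F) m) n = (if i \<le> m then coeff (coeff F (m - i)) n else 0)"
  by (induction i arbitrary: m) (auto simp: mult_lam_def coeff_pCons split: nat.split)

lemma coeff_mult_mu: "coeff (coeff (mult_mu F) m) n = coeff (pCons 0 (coeff F m)) n"
  by (simp add: mult_mu_def coeff_map_poly)

lemma coeff_mult_mu_pow:
  "coeff (coeff ((mult_mu ^^ i) F) m) n = (if i \<le> n then coeff (coeff F m) (n - i) else 0)"
  by (induction i arbitrary: n) (auto simp: coeff_mult_mu coeff_pCons split: nat.split)

lemma sum_fun_apply: "(\<Sum>i\<in>I. f i) x = (\<Sum>i\<in>I. f i x)"
  by (induction I rule: infinite_finite_induct) simp_all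

lemma coeff_const_const:
  "coeff (coeff [:[:x:]:] m) n = (if m = 0 \<and> n = 0 then x else 0)"
  by (auto simp: coeff_pCons split: nat.split)

lemma coeff_poly_at_mult_lam:
  "coeff (coeff (poly_at mult_lam f) m) n = (if n = 0 then coeff f m else 0)"
proof -
  have "coeff (coeff (poly_at mult_lam f) m) n =
      (\<Sum>i\<le>degree f. if i = m then (if n = 0 then coeff f m else 0) else 0)"
    unfolding poly_at_def poly_subst_def coeff_sum coeff_mult_lam_pow coeff_const_const
    by (intro sum.cong) auto
  then show ?thesis by (auto simp: coeff_eq_0)
qed

lemma coeff_poly_at_mult_mu:
  "coeff (coeff (poly_at mult_mu f) m) n = (if m = 0 then coeff f n else 0)"
proof -
  have "coeff (coeff (poly_at mult_mu f) m) n =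
      (\<Sum>i\<le>degree f. if i = n then (if m = 0 then coeff f n else 0) else 0)"
    unfolding poly_at_def poly_subst_def coeff_sum coeff_mult_mu_pow coeff_const_const
    by (intro sum.cong) auto
  then show ?thesis by (auto simp: coeff_eq_0)
qed

text \<open>
  The coefficient of \<open>\<lambda>\<^sup>m \<mu>\<^sup>n\<close> in \<open>a\<^sub>\<lambda> g(\<mu>)\<close>. The value at \<open>0\<close> has to vanish because \<open>n\<close> may exceed the
  degree of \<open>g\<close>.
\<close>

lemma coeff_lam_right_lam_mu:
  assumes "P a 0 = 0"
  shows "coeff (coeff (lam_right P mult_lam a mult_mu g) m) n = coeff (P a (coeff g n)) m"
proof -
  have "coeff (coeff (lam_right P mult_lam a mult_mu g) m) n =
      (\<Sum>i\<le>degree g. if i = n then coeff (P a (coeff g n)) m else 0)"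
    unfolding lam_right_def poly_subst_def coeff_sum coeff_mult_mu_pow coeff_poly_at_mult_lam
    by (intro sum.cong) auto
  then show ?thesis by (auto simp: coeff_eq_0 assms)
qed

lemma coeff_lam_right_mu_lam:
  assumes "P b 0 = 0"
  shows "coeff (coeff (lam_right P mult_mu b mult_lam g) m) n = coeff (P b (coeff g m)) n"
proof -
  have "coeff (coeff (lam_right P mult_mu b mult_lam g) m) n =
      (\<Sum>i\<le>degree g. if i = m then coeff (P b (coeff g m)) n else 0)"
    unfolding lam_right_def poly_subst_def coeff_sum coeff_mult_lam_pow coeff_poly_at_mult_mu
    by (intro sum.cong) auto
  then show ?thesis by (auto simp: coeff_eq_0 assms)
qed

context complex_vector_space
begin

lemma coeff_mult_lam_mu_pow:
  "coeff (coeff ((mult_lam_mu ^^ i) [:[:x:]:]) m) n =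
    (if m + n = i then fd_scale (of_nat (i choose n)) x else 0)"
proof (induction i arbitrary: m n)
  case 0
  then show ?case by (simp add: coeff_const_const fun_eq_iff)
next
  case (Suc i)
  have "(mult_lam_mu ^^ Suc i) [:[:x:]:] =
      mult_lam ((mult_lam_mu ^^ i) [:[:x:]:]) + mult_mu ((mult_lam_mu ^^ i) [:[:x:]:])"
    by (simp add: mult_lam_mu_def)
  then show ?case
    by (cases m; cases n)
      (auto simp: coeff_mult_mu mult_lam_def Suc.IH fd.scale_left_distrib
        simp del: funpow.simps)
qed

lemma coeff_poly_at_mult_lam_mu:
  "coeff (coeff (poly_at mult_lam_mu f) m) n = fd_scale (of_nat (m + n choose n)) (coeff f (m + n))"
proof -
  have "coeff (coeff (poly_at mult_lam_mu f) m) n =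
      (\<Sum>i\<le>degree f. if i = m + n then fd_scale (of_nat (m + n choose n)) (coeff f (m + n)) else 0)"
    unfolding poly_at_def poly_subst_def coeff_sum coeff_mult_lam_mu_pow
    by (intro sum.cong) auto
  then show ?thesis by (auto simp: coeff_eq_0)
qed

text \<open>
  The coefficient of \<open>\<lambda>\<^sup>m \<mu>\<^sup>n\<close> in \<open>f(\<lambda>)\<^bsub>\<lambda>+\<mu>\<^esub> c\<close>: a power \<open>\<lambda>\<^sup>i\<close> comes from \<open>f\<close>, and \<open>\<lambda>\<^bsup>m-i\<^esup> \<mu>\<^sup>n\<close> from the
  binomial expansion of \<open>(\<lambda> + \<mu>)\<^bsup>m-i+n\<^esup>\<close>.
\<close>

lemma coeff_lam_left:
  assumes "P 0 c = 0"
  shows "coeff (coeff (lam_left P mult_lam_mu mult_lam f c) m) n =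
    (\<Sum>i\<le>m. fd_scale (of_nat (m - i + n choose n)) (coeff (P (coeff f i) c) (m - i + n)))"
proof -
  let ?t = "\<lambda>i. if i \<le> m then
    fd_scale (of_nat (m - i + n choose n)) (coeff (P (coeff f i) c) (m - i + n)) else 0"
  let ?M = "max m (degree f)"
  have "coeff (coeff (lam_left P mult_lam_mu mult_lam f c) m) n = (\<Sum>i\<le>degree f. ?t i)"
    unfolding lam_left_def poly_subst_def coeff_sum coeff_mult_lam_pow coeff_poly_at_mult_lam_mu ..
  also have "\<dots> = (\<Sum>i\<le>?M. ?t i)"
    by (intro sum.mono_neutral_left) (auto simp: coeff_eq_0 assms)
  also have "\<dots> = (\<Sum>i\<le>m. ?t i)"
    by (intro sum.mono_neutral_right) auto
  finally show ?thesis by simp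
qed

lemma fd_deriv_pow_apply:
  "(D ^^ j) x k = scale ((-1) ^ j * fact j * (of_int k gchoose j)) (x (k - int j))"
proof (induction j arbitrary: k)
  case 0
  then show ?case by simp
next
  case (Suc j)
  have "(of_int k gchoose Suc j) * fact (Suc j) = of_int k * (fact j * (of_int (k - 1) gchoose j) :: complex)"
    using gbinomial_absorption'[of "Suc j" "of_int k :: complex"] of_nat_neq_0[of j, where 'a = complex]
    by (simp add: field_simps del: of_nat_Suc)
  then have "(-1) ^ Suc j * fact (Suc j) * (of_int k gchoose Suc j) =
      (-1) ^ Suc j * (of_int k * (fact j * (of_int (k - 1) gchoose j)) :: complex)"
    by (simp only: mult.assoc mult.commute[of "fact (Suc j)"])
  then have "- of_int k * ((-1) ^ j * fact j * (of_int (k - 1) gchoose j)) =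
      ((-1) ^ Suc j * fact (Suc j) * (of_int k gchoose Suc j) :: complex)"
    by simp
  note coefficient = this
  have "(D ^^ Suc j) x k = scale (- of_int k) ((D ^^ j) x (k - 1))"
    by (simp add: fd_deriv_def)
  also have "\<dots> = scale ((-1) ^ Suc j * fact (Suc j) * (of_int k gchoose Suc j)) (x (k - 1 - int j))"
    by (simp only: Suc.IH scale_scale coefficient)
  also have "k - 1 - int j = k - int (Suc j)"
    by simp
  finally show ?case .
qed

text \<open>
  Multiplication by \<open>-\<lambda>-\<partial>\<close>, the operator substituted for the variable in \<^const>\<open>subst_skew\<close>.
\<close>

definition skew_variable :: "'p fdist poly \<Rightarrow> 'p fdist poly" where
  "skew_variable g = - pCons 0 g - map_poly D g"

lemma coeff_skew_variable:
  "coeff (skew_variable g) n = - coeff (pCons 0 g) n - D (coeff g n)"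
  by (simp add: skew_variable_def coeff_map_poly fd_deriv_linear del: minus_pCons)

lemma coeff_skew_variable_pow:
  "coeff ((skew_variable ^^ i) [:x:]) n =
    fd_scale ((-1) ^ i * of_nat (i choose n)) ((D ^^ (i - n)) x)"
proof (induction i arbitrary: n)
  case 0
  then show ?case by (simp add: coeff_pCons fun_eq_iff split: nat.split)
next
  case (Suc i)
  show ?case
  proof (cases n)
    case 0
    then show ?thesis
      by (simp add: coeff_skew_variable fd_deriv_linear Suc.IH)
  next
    case (Suc n')
    have "fd_scale ((-1) ^ i * of_nat (i choose n)) (D ((D ^^ (i - n)) x)) =
        fd_scale ((-1) ^ i * of_nat (i choose n)) ((D ^^ (Suc i - n)) x)"
      by (cases "n \<le> i") (simp_all add: Suc_diff_le)
    then have "coeff ((skew_variable ^^ Suc i) [:x:]) n =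
        - fd_scale ((-1) ^ i * of_nat (i choose n')) ((D ^^ (Suc i - n)) x) -
        fd_scale ((-1) ^ i * of_nat (i choose n)) ((D ^^ (Suc i - n)) x)"
      using Suc by (simp add: coeff_skew_variable fd_deriv_linear Suc.IH)
    also have "\<dots> = fd_scale (- ((-1) ^ i * of_nat (i choose n')) - (-1) ^ i * of_nat (i choose n))
        ((D ^^ (Suc i - n)) x)"
      by (simp only: fd.scale_left_diff_distrib fd.scale_minus_left)
    also have "- ((-1) ^ i * of_nat (i choose n')) - (-1) ^ i * of_nat (i choose n) =
        ((-1) ^ Suc i * of_nat (Suc i choose n) :: complex)"
      using Suc by (simp add: algebra_simps)
    finally show ?thesis .
  qed
qed

lemma coeff_subst_skew:
  assumes "\<And>i. i \<ge> N \<Longrightarrow> coeff f i = 0"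
  shows "coeff (subst_skew D f) n =
    (\<Sum>i<N. fd_scale ((-1) ^ i * of_nat (i choose n)) ((D ^^ (i - n)) (coeff f i)))"
proof -
  have "coeff ((skew_variable ^^ i) [:0:]) n = coeff 0 n" for i n
    by (simp only: coeff_skew_variable_pow)
      (simp add: additive.zero[OF additive_funpow[OF additive_fd_deriv]])
  then have zero: "(skew_variable ^^ i) [:0:] = 0" for i
    by (rule poly_eqI)
  have "subst_skew D f = poly_subst skew_variable (\<lambda>x. [:x:]) f"
    by (simp only: subst_skew_def skew_variable_def[abs_def])
  also have "\<dots> = (\<Sum>i<N. (skew_variable ^^ i) [:coeff f i:])"
    by (intro poly_subst_eq_sum assms zero)
  finally show ?thesis
    by (simp only: coeff_sum coeff_skew_variable_pow)
qed

section \<open>Generating functions of the products\<close>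

lemma coeff_fd_lambda:
  assumes "finite {n. fd_nprod p n a b \<noteq> 0}"
  shows "coeff (fd_lambda scale p a b) n = fd_scale (1 / fact n) (fd_nprod p n a b)"
proof -
  have "coeff (fd_lambda scale p a b) n = (\<Sum>i | fd_nprod p i a b \<noteq> 0.
      if i = n then fd_scale (1 / fact n) (fd_nprod p n a b) else 0)"
    unfolding fd_lambda_def coeff_sum by (intro sum.cong) (auto simp: fd_scale_def)
  then show ?thesis
    using assms by (auto simp: sum.delta)
qed

text \<open>
  For \<open>\<epsilon> = -1\<close> this is skew-symmetry of the \<open>\<lambda>\<close>-bracket, for \<open>\<epsilon> = 1\<close> commutativity of the
  \<open>\<lambda>\<close>-product.
\<close>

lemma fd_lambda_skew:
  assumes swap: "\<And>x y. p y x = scale \<epsilon> (p x y)"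
    and ab: "fd_prod_local p a b" and ba: "fd_prod_local p b a"
  shows "coeff (fd_lambda scale p a b) n =
    fd_scale \<epsilon> (coeff (subst_skew D (fd_lambda scale p b a)) n)"
proof (rule ext)
  fix k
  obtain N where N: "(zw ^^ N) (fd_outer p b a) = 0"
    using ba by (auto simp: fd_prod_local_def)
  have zero: "fd_nprod p i b a = 0" if "N \<le> i" for i
    using funpow_additive_zero_mono[OF additive_mult_z_minus_w N that]
    by (simp add: fd_nprod_def Res_z_def fun_eq_iff)
  note coeffs = coeff_fd_lambda[OF fd_nprod_finite]
  let ?t = "\<lambda>i. fd_scale ((-1) ^ i * of_nat (i choose n))
    ((D ^^ (i - n)) (coeff (fd_lambda scale p b a) i))"
  have "coeff (subst_skew D (fd_lambda scale p b a)) n = (\<Sum>i<n + N. ?t i)"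
    by (rule coeff_subst_skew) (simp add: coeffs ba zero)
  \<comment> \<open>The terms below \<open>n\<close> carry a vanishing binomial coefficient.\<close>
  also have "\<dots> = (\<Sum>i = 0 + n..<N + n. ?t i)"
    by (intro sum.mono_neutral_right) auto
  also have "\<dots> = (\<Sum>j<N. ?t (j + n))"
    by (simp only: sum.shift_bounds_nat_ivl atLeast0LessThan)
  finally have "coeff (subst_skew D (fd_lambda scale p b a)) n k = (\<Sum>j<N. ?t (j + n) k)"
    by (simp add: sum_fun_apply)
  moreover have "?t (j + n) k = scale ((-1) ^ n / fact n)
      (scale (of_int k gchoose j) (fd_nprod p (n + j) b a (k - int j)))" for j
  proof -
    have "(-1) ^ (j + n) * of_nat (j + n choose n) * (1 / fact (j + n) * ((-1) ^ j * fact j * g)) =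
      (-1) ^ n / fact n * g" for g :: complex
      by (simp add: binomial_fact power_add field_simps)
    then show ?thesis
      by (simp add: coeffs ba fd_deriv_pow_scale)
        (simp add: fd_scale_def fd_deriv_pow_apply add.commute[of n])
  qed
  ultimately show "coeff (fd_lambda scale p a b) n k =
      fd_scale \<epsilon> (coeff (subst_skew D (fd_lambda scale p b a)) n) k"
    by (simp add: coeffs ab fd_scale_def fd_nprod_skew[OF swap N] scale_sum_right ac_simps)
qed

text \<open>
  The generating function form of the expansion of nested \<open>n\<close>-th products. The factorials in the
  definition of the \<open>\<lambda>\<close>-product turn the binomial coefficients \<open>m choose j\<close> into those of the
  substitution \<open>\<lambda> + \<mu>\<close>.
\<close>

lemma fd_lambda_nested:
  assumes bilin: "\<And>p. p \<in> {p1, p2, p3, p4, p5, p6} \<Longrightarrow> bilinear_op p"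
    and expand: "\<And>x y z. p1 x (p2 y z) = p3 (p4 x y) z + p5 y (p6 x z)"
    and fin: "\<And>p a b. p \<in> {p1, p2, p3, p4, p5, p6} \<Longrightarrow> a \<in> A \<Longrightarrow> b \<in> A \<Longrightarrow>
      finite {n. fd_nprod p n a b \<noteq> 0}"
    and closed: "\<And>p n a b. p \<in> {p2, p4, p6} \<Longrightarrow> a \<in> A \<Longrightarrow> b \<in> A \<Longrightarrow> fd_nprod p n a b \<in> A"
    and scale: "\<And>c a. a \<in> A \<Longrightarrow> fd_scale c a \<in> A"
    and abc: "a \<in> A" "b \<in> A" "c \<in> A"
  shows "lam_right (fd_lambda scale p1) mult_lam a mult_mu (fd_lambda scale p2 b c) =
    lam_left (fd_lambda scale p3) mult_lam_mu mult_lam (fd_lambda scale p4 a b) c +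
    lam_right (fd_lambda scale p5) mult_mu b mult_lam (fd_lambda scale p6 a c)"
proof (intro poly_eqI)
  fix m n
  have zero: "fd_lambda scale p x 0 = 0" "fd_lambda scale p 0 x = 0"
    if "p \<in> {p1, p2, p3, p4, p5, p6}" for p x
    by (simp_all add: fd_lambda_def fd_nprod_def Res_z_def fd_outer_linear[OF bilin[OF that]])
  note coeffs = coeff_fd_lambda[OF fin]
  note nprod_scale = fd_nprod_scale[OF bilin]
  have "coeff (coeff (lam_right (fd_lambda scale p1) mult_lam a mult_mu (fd_lambda scale p2 b c)) m) n =
      fd_scale (1 / (fact m * fact n)) (fd_nprod p1 m a (fd_nprod p2 n b c))"
    by (simp add: coeff_lam_right_lam_mu zero coeffs closed scale abc nprod_scale)
  moreover have "coeff (coeff (lam_right (fd_lambda scale p5) mult_mu b mult_lam (fd_lambda scale p6 a c)) m) n =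
      fd_scale (1 / (fact m * fact n)) (fd_nprod p5 n b (fd_nprod p6 m a c))"
    by (simp add: coeff_lam_right_mu_lam zero coeffs closed scale abc nprod_scale mult.commute)
  moreover have "coeff (coeff (lam_left (fd_lambda scale p3) mult_lam_mu mult_lam (fd_lambda scale p4 a b) c) m) n =
      fd_scale (1 / (fact m * fact n)) (\<Sum>j\<le>m. fd_scale (of_nat (m choose j))
        (fd_nprod p3 (n + m - j) (fd_nprod p4 j a b) c))"
  proof -
    \<comment> \<open>Both sides equal \<open>1 / ((m - j)! n! j!)\<close>.\<close>
    have "of_nat (m - j + n choose n) * (1 / fact (m - j + n) * (1 / fact j)) =
        1 / (fact m * fact n) * (of_nat (m choose j) :: complex)" if "j \<le> m" for j
      using that by (simp add: binomial_fact field_simps)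
    then show ?thesis
      by (auto simp: coeff_lam_left zero coeffs closed scale abc nprod_scale fd.scale_sum_right
          add.commute[of n] intro!: sum.cong)
  qed
  moreover have "fd_nprod p1 m a (fd_nprod p2 n b c) =
      (\<Sum>j\<le>m. fd_scale (of_nat (m choose j)) (fd_nprod p3 (n + m - j) (fd_nprod p4 j a b) c)) +
      fd_nprod p5 n b (fd_nprod p6 m a c)"
  proof -
    have "additive (p1 x)" "additive (\<lambda>y. p3 y x)" "additive (p5 x)" for x
      by (simp_all add: bilin bilinear_op_additive)
    then show ?thesis
      by (intro ext) (simp add: fd_nprod_nested[of p1 p3 p5 p2 p4 p6, OF _ _ _ expand] sum_fun_apply fd_scale_def)
  qed
  ultimately show "coeff (coeff (lam_right (fd_lambda scale p1) mult_lam a mult_mu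
        (fd_lambda scale p2 b c)) m) n =
      coeff (coeff (lam_left (fd_lambda scale p3) mult_lam_mu mult_lam (fd_lambda scale p4 a b) c +
        lam_right (fd_lambda scale p5) mult_mu b mult_lam (fd_lambda scale p6 a c)) m) n"
    by (simp add: fd.scale_right_distrib)
qed

text \<open>
  Sesquilinearity is the derivative rule for \<open>n\<close>-th products: the factor \<open>n\<close> there cancels against
  \<open>n!\<close> and shifts the index, which is multiplication by \<open>\<lambda>\<close>.
\<close>

lemma conformal_algebra_fd_lambda:
  assumes p: "bilinear_op p"
    and A: "module.subspace (fd_act scale) A"
    and closed: "\<And>n a b. a \<in> A \<Longrightarrow> b \<in> A \<Longrightarrow> fd_nprod p n a b \<in> A"
    and fin: "\<And>a b. a \<in> A \<Longrightarrow> b \<in> A \<Longrightarrow> finite {n. fd_nprod p n a b \<noteq> 0}"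
  shows "conformal_algebra (fd_act scale) A (fd_lambda scale p)"
proof -
  interpret act: module "fd_act scale" by (rule module_fd_act)
  have A_add: "a + b \<in> A" and A_act: "fd_act scale q a \<in> A" if "a \<in> A" "b \<in> A" for a b q
    using A that by (auto simp: act.subspace_def)
  have A_scale: "fd_scale c a \<in> A" and A_deriv: "D a \<in> A" if "a \<in> A" for a c
    using A_act[OF that that, of "[:c:]"] A_act[OF that that, of "[:0, 1:]"]
    by (simp_all add: fd_act_const fd_act_X)
  note act_simps = fd_act_const fd_act_X
  note coeffs = coeff_fd_lambda[OF fin] fd_nprod_add[OF p] fd_nprod_scale[OF p]
  show ?thesis
  proof
    show "act.subspace A" by (rule A)
  next
    fix a b assume ab: "a \<in> A" "b \<in> A"
    show "coeff (fd_lambda scale p a b) n \<in> A" for n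
      by (simp add: coeffs ab closed A_scale)
    show "fd_lambda scale p (fd_act scale [:c:] a) b =
        map_poly (fd_act scale [:c:]) (fd_lambda scale p a b)" for c
      by (rule poly_eqI) (simp add: act_simps coeffs ab A_scale coeff_map_poly mult.commute)
    show "fd_lambda scale p a (fd_act scale [:c:] b) =
        map_poly (fd_act scale [:c:]) (fd_lambda scale p a b)" for c
      by (rule poly_eqI) (simp add: act_simps coeffs ab A_scale coeff_map_poly mult.commute)
    have factorial_ratio: "1 / fact (Suc n) * of_nat (Suc n) = (1 / fact n :: complex)" for n
      using of_nat_neq_0[of n, where 'a = complex] by (simp del: of_nat_Suc)
    show "fd_lambda scale p (fd_act scale [:0, 1:] a) b = - pCons 0 (fd_lambda scale p a b)"
      by (rule poly_eqI)
        (auto simp: act_simps coeffs ab A_deriv fd_nprod_deriv_left[OF p] coeff_pCons factorial_ratio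
          simp del: times_divide_eq_left fact_Suc of_nat_Suc split: nat.split)
    show "fd_lambda scale p a (fd_act scale [:0, 1:] b) =
        map_poly (fd_act scale [:0, 1:]) (fd_lambda scale p a b) + pCons 0 (fd_lambda scale p a b)"
      by (rule poly_eqI)
        (auto simp: act_simps coeffs ab A_deriv fd_nprod_deriv_right[OF p] coeff_pCons coeff_map_poly
          fd_deriv_linear fd.scale_right_distrib factorial_ratio
          simp del: times_divide_eq_left fact_Suc of_nat_Suc split: nat.split)
  next
    fix a a' b assume "a \<in> A" "a' \<in> A" "b \<in> A"
    then show "fd_lambda scale p (a + a') b = fd_lambda scale p a b + fd_lambda scale p a' b"
      by (intro poly_eqI) (simp add: coeffs A_add fd.scale_right_distrib)
  next
    fix a b b' assume "a \<in> A" "b \<in> A" "b' \<in> A"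
    then show "fd_lambda scale p a (b + b') = fd_lambda scale p a b + fd_lambda scale p a b'"
      by (intro poly_eqI) (simp add: coeffs A_add fd.scale_right_distrib)
  qed
qed

end

section \<open>Locality in a Poisson algebra\<close>

sublocale noncomm_poisson_algebra \<subseteq> complex_vector_space scale ..

context noncomm_poisson_algebra
begin

lemma bilinear_prd: "bilinear_op prd" and bilinear_brk: "bilinear_op brk"
  by (auto simp: bilinear_op_def prd_linear_left prd_linear_right brk_linear_left brk_linear_right)

lemmas prd_additive = bilinear_op_additive[OF bilinear_prd]
lemmas brk_additive = bilinear_op_additive[OF bilinear_brk]

lemma brk_skew: "brk y x = - brk x y"
proof -
  have "0 = brk (x + y) (x + y)"
    by (simp only: brk_self)
  also have "\<dots> = brk x y + brk y x"
    by (simp only: brk_additive[THEN additive.add]) (simp add: brk_self)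
  finally have "brk x y + brk y x = 0" ..
  then show ?thesis by (simp add: add_eq_0_iff2)
qed

lemma jacobi_leibniz: "brk x (brk y z) = brk (brk x y) z + brk y (brk x z)"
proof -
  have "brk x (brk y z) = - brk y (brk z x) - brk z (brk x y)"
    using brk_jacobi[of x y z] by (simp add: algebra_simps eq_neg_iff_add_eq_0)
  also have "\<dots> = brk (brk x y) z + brk y (brk x z)"
    by (simp add: brk_skew[of z "brk x y"] brk_skew[of z x] brk_additive[THEN additive.minus])
  finally show ?thesis .
qed

abbreviation "local \<equiv> fd_local prd brk"

lemma fd_local_sym: "local a b \<Longrightarrow> local b a"
proof -
  have "fd_prod_local brk b a" if ab: "fd_prod_local brk a b"
  proof -
    obtain N where "(zw ^^ N) (fd_outer brk a b) = 0"
      using ab by (auto simp: fd_prod_local_def)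
    moreover have "fd_outer (\<lambda>x y. brk y x) a b = - fd_outer brk a b"
      by (auto simp: fd_outer_def fun_eq_iff intro: brk_skew)
    ultimately have "fd_prod_local (\<lambda>x y. brk y x) a b"
      by (auto simp: fd_prod_local_def zw_pow_minus)
    then show ?thesis by (simp only: fd_prod_local_swap[of brk])
  qed
  then show "local a b \<Longrightarrow> local b a"
    by (simp add: fd_local_iff_prod_local)
qed

lemma local_iff_prod_local:
  "local a b \<longleftrightarrow>
    fd_prod_local brk a b \<and> fd_prod_local prd a b \<and> fd_prod_local (\<lambda>x y. prd y x) a b"
  by (simp only: fd_local_iff_prod_local fd_prod_local_swap[of prd])

lemma fd_local_linear:
  "local 0 c"
  "local a c \<Longrightarrow> local b c \<Longrightarrow> local (a + b) c"
  "local a c \<Longrightarrow> local (fd_scale s a) c"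
  "local a c \<Longrightarrow> local (D a) c"
  by (simp_all add: local_iff_prod_local fd_prod_local_zero fd_prod_local_add fd_prod_local_scale fd_prod_local_deriv
      bilinear_prd bilinear_brk bilinear_op_swap)

text \<open>
  In each of the three conditions the outer product is distributed over the inner one: by the Leibniz
  rule for the bracket \<open>[ab, c]\<close>, by associativity for \<open>(ab)c\<close> and for \<open>c(ab)\<close>. The last one is read as a
  product in the opposite algebra.
\<close>

lemma fd_local_nprod_prd:
  assumes "local a b" "local a c" "local b c"
  shows "local (fd_nprod prd j a b) c"
proof -
  note loc = assms[unfolded fd_local_iff_prod_local]
  note add = prd_additive brk_additive
  have "fd_prod_local brk (fd_nprod prd j a b) c"
  proof (rule fd_prod_local_nprod[where s = prd and s' = brk and t = "\<lambda>y u. prd u y" and t' = brk])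
    show "brk (prd x y) z = prd x (brk y z) + prd (brk x z) y" for x y z
    proof -
      have "brk (prd x y) z = - brk z (prd x y)"
        by (rule brk_skew)
      also have "\<dots> = prd x (brk y z) + prd (brk x z) y"
        by (simp add: leibniz brk_skew[of z x] brk_skew[of z y] prd_additive[THEN additive.minus])
      finally show ?thesis .
    qed
  qed (use loc add in auto)
  moreover have "fd_prod_local prd (fd_nprod prd j a b) c"
    by (rule fd_prod_local_nprod[where s = prd and s' = prd and t = "\<lambda>_ _. 0" and t' = prd])
      (use loc add in \<open>auto simp: prd_assoc additive_def\<close>)
  moreover have "fd_prod_local (\<lambda>x y. prd y x) (fd_nprod prd j a b) c"
    by (rule fd_prod_local_nprod[where s = "\<lambda>_ _. 0" and s' = prd and t = "\<lambda>y u. prd u y"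
          and t' = "\<lambda>x y. prd y x"])
      (use loc add in \<open>auto simp: prd_assoc additive_def fd_prod_local_swap[of prd]\<close>)
  ultimately show ?thesis
    by (simp only: fd_local_iff_prod_local fd_prod_local_swap[of prd])
qed

text \<open>
  As before, now with the Jacobi identity for \<open>[[a, b], c]\<close> and the Leibniz rule, solved for the term
  with the inner bracket, for \<open>[a, b]c\<close> and \<open>c[a, b]\<close>.
\<close>

lemma fd_local_nprod_brk:
  assumes "local a b" "local a c" "local b c"
  shows "local (fd_nprod brk j a b) c"
proof -
  note loc = assms[unfolded fd_local_iff_prod_local]
  note add = prd_additive brk_additive
  have minus: "additive (\<lambda>u. - h u)" if "additive h" for h :: "'p \<Rightarrow> 'p"
    using that by (simp add: additive_def)
  have "fd_prod_local brk (fd_nprod brk j a b) c"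
  proof (rule fd_prod_local_nprod[where s = brk and s' = brk and t = "\<lambda>y u. - brk y u" and t' = brk])
    show "brk (brk x y) z = brk x (brk y z) + - brk y (brk x z)" for x y z
      using jacobi_leibniz[of x y z] by simp
  qed (use loc add minus in auto)
  moreover have "fd_prod_local prd (fd_nprod brk j a b) c"
    by (rule fd_prod_local_nprod[where s = brk and s' = prd and t = "\<lambda>y u. - prd y u" and t' = brk])
      (use loc add in \<open>auto simp: leibniz minus\<close>)
  moreover have "fd_prod_local (\<lambda>x y. prd y x) (fd_nprod brk j a b) c"
    by (rule fd_prod_local_nprod[where s = brk and s' = "\<lambda>x y. prd y x" and t = "\<lambda>y u. - prd u y"
          and t' = brk])
      (use loc add in \<open>auto simp: leibniz minus fd_prod_local_swap[of prd]\<close>)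
  ultimately show ?thesis
    by (simp only: fd_local_iff_prod_local fd_prod_local_swap[of prd])
qed

definition commutant :: "'p fdist set \<Rightarrow> 'p fdist set" where
  "commutant S = {b. \<forall>a\<in>S. local b a}"

abbreviation fd_closed :: "'p fdist set \<Rightarrow> bool" where
  "fd_closed M \<equiv> module.subspace (fd_act scale) M \<and>
    (\<forall>a\<in>M. \<forall>b\<in>M. \<forall>j. fd_nprod prd j a b \<in> M \<and> fd_nprod brk j a b \<in> M)"

text \<open>
  Dong's lemma needs the two factors of a product to be local to one another, which membership in a
  commutant does not imply; hence the hypothesis. The double commutant of a pairwise local set
  satisfies it.
\<close>

lemma fd_closed_commutant:
  assumes "\<And>a b. a \<in> commutant S \<Longrightarrow> b \<in> commutant S \<Longrightarrow> local a b"
  shows "fd_closed (commutant S)"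
proof -
  interpret act: module "fd_act scale" by (rule module_fd_act)
  have "0 \<in> commutant S"
    by (simp add: commutant_def fd_local_linear)
  moreover have "a + b \<in> commutant S" if "a \<in> commutant S" "b \<in> commutant S" for a b
    using that by (simp add: commutant_def fd_local_linear)
  moreover have "fd_act scale q a \<in> commutant S" if "a \<in> commutant S" for q a
    by (rule fd_act_closed) (use that in \<open>auto simp: commutant_def fd_local_linear\<close>)
  ultimately have "act.subspace (commutant S)"
    unfolding act.subspace_def by blast
  moreover have "fd_nprod prd j a b \<in> commutant S" "fd_nprod brk j a b \<in> commutant S"
    if "a \<in> commutant S" "b \<in> commutant S" for a b j
    using assms[OF that] that
    by (auto simp: commutant_def fd_local_nprod_prd fd_local_nprod_brk)
  ultimately show ?thesis by blast
qed

lemma fd_closed_fd_closure: "fd_closed (fd_closure scale prd brk \<F>)"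
proof -
  interpret act: module "fd_act scale" by (rule module_fd_act)
  show ?thesis
    unfolding fd_closure_def by (rule hull_in) (auto intro!: act.subspace_Inter)
qed

end

section \<open>The conformal algebra of a formal distribution Poisson algebra\<close>

context fd_noncomm_poisson_algebra
begin

abbreviation "Fbar \<equiv> fd_closure scale prd brk \<F>"

text \<open>
  In an induction over the generation of \<open>Fbar\<close>, locality of a product to a fixed distribution would
  require locality of its two factors to one another, which is an instance of the claim itself.
  The double commutant of \<open>\<F>\<close> breaks this circle: \<open>\<F>\<close> is contained in its commutant, hence the double
  commutant is as well, which makes it pairwise local. Then it is closed under all
  operations and contains the minimal closed set \<open>Fbar\<close>.
\<close>

lemma Fbar_local:
  assumes "a \<in> Fbar" "b \<in> Fbar"
  shows "local a b"
proof -
  let ?M = "commutant (commutant \<F>)"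
  have F: "\<F> \<subseteq> commutant \<F>" "\<F> \<subseteq> ?M"
    by (auto simp: commutant_def pairwise_local fd_local_sym)
  have M: "local a b" if "a \<in> ?M" "b \<in> ?M" for a b
  proof -
    have "?M \<subseteq> commutant \<F>" using F(1) by (auto simp: commutant_def)
    then have "b \<in> commutant \<F>" using that by blast
    then show ?thesis using that(1) by (simp add: commutant_def[of "commutant \<F>"])
  qed
  have "Fbar \<subseteq> ?M"
    unfolding fd_closure_def by (rule hull_minimal[OF F(2)]) (rule fd_closed_commutant[OF M])
  then show ?thesis using assms M by blast
qed

lemma Fbar_nprod_finite:
  assumes "a \<in> Fbar" "b \<in> Fbar"
  shows "finite {n. fd_nprod prd n a b \<noteq> 0}" "finite {n. fd_nprod brk n a b \<noteq> 0}"
  using Fbar_local[OF assms] by (auto simp: fd_local_iff_prod_local intro: fd_nprod_finite)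

lemma Fbar_closed:
  "module.subspace (fd_act scale) Fbar"
  "a \<in> Fbar \<Longrightarrow> b \<in> Fbar \<Longrightarrow> fd_nprod prd n a b \<in> Fbar"
  "a \<in> Fbar \<Longrightarrow> b \<in> Fbar \<Longrightarrow> fd_nprod brk n a b \<in> Fbar"
  using fd_closed_fd_closure[of \<F>] by auto

lemma Fbar_scale: "0 \<in> Fbar" "a \<in> Fbar \<Longrightarrow> fd_scale c a \<in> Fbar"
proof -
  interpret act: module "fd_act scale" by (rule module_fd_act)
  show "0 \<in> Fbar" "a \<in> Fbar \<Longrightarrow> fd_scale c a \<in> Fbar"
    using Fbar_closed(1) act.subspace_0 act.subspace_scale[of Fbar a "[:c:]"]
    by (simp_all add: fd_act_const)
qed

lemma fd_nprod_null: "fd_nprod (\<lambda>_ _. 0) n a b = 0"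
proof -
  have "fd_outer (\<lambda>_ _. 0) a b = 0" by (simp add: fd_outer_def fun_eq_iff)
  then show ?thesis by (simp only: fd_nprod_def Res_z_def zw_pow_zero) (simp add: fun_eq_iff)
qed

lemma noncomm_poisson_conformal_Fbar:
  "noncomm_poisson_conformal_algebra (fd_act scale) Fbar (fd_lambda scale prd) (fd_lambda scale brk)"
proof -
  note facts = Fbar_nprod_finite Fbar_closed(2,3) Fbar_scale bilinear_prd bilinear_brk
  interpret circ: conformal_algebra "fd_act scale" Fbar "fd_lambda scale prd"
    by (rule conformal_algebra_fd_lambda) (simp_all add: facts Fbar_closed)
  interpret bracket: conformal_algebra "fd_act scale" Fbar "fd_lambda scale brk"
    by (rule conformal_algebra_fd_lambda) (simp_all add: facts Fbar_closed)
  show ?thesis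
  proof
    fix a b c assume abc: "a \<in> Fbar" "b \<in> Fbar" "c \<in> Fbar"
    \<comment> \<open>Associativity is the nested expansion with the zero operation in its last term.\<close>
    have null: "fd_lambda scale (\<lambda>_ _. 0) x y = 0" for x y
      by (simp add: fd_lambda_def fd_nprod_null)
    have "lam_right (fd_lambda scale (\<lambda>_ _. 0)) mult_mu b mult_lam (fd_lambda scale prd a c) = 0"
      by (intro poly_eqI) (simp add: coeff_lam_right_mu_lam null)
    moreover have "lam_right (fd_lambda scale prd) mult_lam a mult_mu (fd_lambda scale prd b c) =
        lam_left (fd_lambda scale prd) mult_lam_mu mult_lam (fd_lambda scale prd a b) c +
        lam_right (fd_lambda scale (\<lambda>_ _. 0)) mult_mu b mult_lam (fd_lambda scale prd a c)"
      by (rule fd_lambda_nested[where A = Fbar])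
        (auto simp: facts abc prd_assoc bilinear_op_zero fd_nprod_null)
    ultimately show "lam_right (fd_lambda scale prd) mult_lam a mult_mu (fd_lambda scale prd b c) =
        lam_left (fd_lambda scale prd) mult_lam_mu mult_lam (fd_lambda scale prd a b) c"
      by simp
    show "lam_right (fd_lambda scale brk) mult_lam a mult_mu (fd_lambda scale brk b c) =
        lam_left (fd_lambda scale brk) mult_lam_mu mult_lam (fd_lambda scale brk a b) c +
        lam_right (fd_lambda scale brk) mult_mu b mult_lam (fd_lambda scale brk a c)"
    proof (rule fd_lambda_nested[where A = Fbar])
      show "brk x (brk y z) = brk (brk x y) z + brk y (brk x z)" for x y z
        by (rule jacobi_leibniz)
    qed (auto simp: facts abc)
    show "lam_right (fd_lambda scale brk) mult_lam a mult_mu (fd_lambda scale prd b c) =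
        lam_left (fd_lambda scale prd) mult_lam_mu mult_lam (fd_lambda scale brk a b) c +
        lam_right (fd_lambda scale prd) mult_mu b mult_lam (fd_lambda scale brk a c)"
      by (rule fd_lambda_nested[where A = Fbar]) (auto simp: facts abc leibniz)
  next
    fix a b assume ab: "a \<in> Fbar" "b \<in> Fbar"
    have loc: "fd_prod_local brk a b" "fd_prod_local brk b a"
      using Fbar_local ab by (auto simp: fd_local_iff_prod_local)
    have "brk y x = scale (- 1) (brk x y)" for x y
      using brk_skew[of y x] by simp
    note skew = fd_lambda_skew[OF this loc]
    have "fd_act scale [:0, 1:] = D" by (simp add: fd_act_X fun_eq_iff)
    then show "fd_lambda scale brk a b =
        - subst_skew (fd_act scale [:0, 1:]) (fd_lambda scale brk b a)"
      by (intro poly_eqI) (simp add: skew)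
  qed
qed

end

context fd_poisson_algebra
begin

lemma poisson_conformal_Fbar:
  "poisson_conformal_algebra (fd_act scale) Fbar (fd_lambda scale prd) (fd_lambda scale brk)"
proof -
  interpret noncomm_poisson_conformal_algebra "fd_act scale" Fbar "fd_lambda scale prd" "fd_lambda scale brk"
    by (rule noncomm_poisson_conformal_Fbar)
  show ?thesis
  proof
    fix a b assume ab: "a \<in> Fbar" "b \<in> Fbar"
    have loc: "fd_prod_local prd a b" "fd_prod_local prd b a"
      using Fbar_local ab by (auto simp: fd_local_iff_prod_local)
    have "prd y x = scale 1 (prd x y)" for x y
      using prd_commute[of y x] by simp
    note symmetric = fd_lambda_skew[OF this loc]
    have "fd_act scale [:0, 1:] = D" by (simp add: fd_act_X fun_eq_iff)
    then show "fd_lambda scale prd a b =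
        subst_skew (fd_act scale [:0, 1:]) (fd_lambda scale prd b a)"
      by (intro poly_eqI) (simp add: symmetric)
  qed
qed

end

theorem theorem3p5:
  fixes scale :: "complex \<Rightarrow> 'p::ab_group_add \<Rightarrow> 'p"
    and prd brk :: "'p \<Rightarrow> 'p \<Rightarrow> 'p"
    and \<F> :: "'p fdist set"
  defines "Fbar \<equiv> fd_closure scale prd brk \<F>"
  shows
    "(fd_noncomm_poisson_algebra scale prd brk \<F> \<longrightarrow>
        (\<forall>a\<in>Fbar. \<forall>b\<in>Fbar.
           finite {n. fd_nprod prd n a b \<noteq> 0} \<and> finite {n. fd_nprod brk n a b \<noteq> 0}) \<and>
        noncomm_poisson_conformal_algebra (fd_act scale) Fbar
          (fd_lambda scale prd) (fd_lambda scale brk)) \<and>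
     (fd_poisson_algebra scale prd brk \<F> \<longrightarrow>
        (\<forall>a\<in>Fbar. \<forall>b\<in>Fbar.
           finite {n. fd_nprod prd n a b \<noteq> 0} \<and> finite {n. fd_nprod brk n a b \<noteq> 0}) \<and>
        poisson_conformal_algebra (fd_act scale) Fbar
          (fd_lambda scale prd) (fd_lambda scale brk))"
proof (intro conjI impI)
  assume "fd_noncomm_poisson_algebra scale prd brk \<F>"
  then interpret fd_noncomm_poisson_algebra scale prd brk \<F> .
  show "\<forall>a\<in>Fbar. \<forall>b\<in>Fbar.
      finite {n. fd_nprod prd n a b \<noteq> 0} \<and> finite {n. fd_nprod brk n a b \<noteq> 0}"
    unfolding Fbar_def by (simp add: Fbar_nprod_finite)
  show "noncomm_poisson_conformal_algebra (fd_act scale) Fbar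
      (fd_lambda scale prd) (fd_lambda scale brk)"
    unfolding Fbar_def by (rule noncomm_poisson_conformal_Fbar)
next
  assume "fd_poisson_algebra scale prd brk \<F>"
  then interpret fd_poisson_algebra scale prd brk \<F> .
  show "\<forall>a\<in>Fbar. \<forall>b\<in>Fbar.
      finite {n. fd_nprod prd n a b \<noteq> 0} \<and> finite {n. fd_nprod brk n a b \<noteq> 0}"
    unfolding Fbar_def by (simp add: Fbar_nprod_finite)
  show "poisson_conformal_algebra (fd_act scale) Fbar
      (fd_lambda scale prd) (fd_lambda scale brk)"
    unfolding Fbar_def by (rule poisson_conformal_Fbar)
qed

end
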